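(* Let $K$ be a non-Archimedean local field with ring of integers $O$ and residue field cardinality $q$, and let $\mathcal H\subset L^2(O)$ be the subspace of radial functions. Let $I_0^1$ be the operator in $\mathcal H$ given by $$ (I_0^1 u)(x)=\frac{1-q}{q\log q}\int\limits_{|y|_K<|x|_K}\left(\log|x|_K-\log|y|_K\right)u(|y|_K)\,dy ,\qquad x\in O . $$ Then $I_0^1$ is a simple Volterra operator in $\mathcal H$ whose imaginary part $J=\frac1{2i}\left(I_0^1-(I_0^1)^*\right)$ has rank $2$ and satisfies $\operatorname{tr}J=0$.
   Context: $K$ is a non-Archimedean local field (a non-discrete totally disconnected locally compact topological field) with absolute value $|\cdot|_K$, $O=\{x\in K:|x|_K\le 1\}$, $P=\{x\in K:|x|_K<1\}$, $q$ is the cardinality of the finite field $O/P$. The absolute value is normalized: its nonzero values are exactly $q^N$, $N\in\mathbb Z$. $dx$ is the Haar measure on the additive group of $K$ with $\int_O dx=1$. $L^2(O)$ is the space of complex-valued functions square integrable on $O$ with respect to $dx$, and $\mathcal H$ is its subspace consisting of radial functions, that is, functions $u(x)=u(|x|_K)$ depending only on $|x|_K$ (a radial function $x\mapsto u(|x|_K)$ is identified with the function $|x|_K\mapsto u(|x|_K)$). A compact operator is called a Volterra operator if its spectrum consists of the unique point $\lambda=0$. An operator $A$ is called simple if $A$ and $A^*$ have no common nontrivial invariant subspace on which these operators coincide. *)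

theory Defs
  imports "HOL-Analysis.Analysis"
begin

section \<open>Non-Archimedean local fields\<close>

class topological_field = field + topological_ab_group_add + topological_semigroup_mult + t2_space +
  assumes inverse_continuous: "a \<noteq> 0 \<Longrightarrow> filterlim inverse (nhds (inverse a)) (nhds a)"

class valued_field = topological_field +
  fixes absK :: "'a \<Rightarrow> real"
  assumes absK_nonneg: "0 \<le> absK x"
    and absK_eq_0_iff: "absK x = 0 \<longleftrightarrow> x = 0"
    and absK_mult: "absK (x * y) = absK x * absK y"
    and absK_add_le_max: "absK (x + y) \<le> max (absK x) (absK y)"
    and open_iff_absK: "open S \<longleftrightarrow> (\<forall>x\<in>S. \<exists>e>0. \<forall>y. absK (y - x) < e \<longrightarrow> y \<in> S)"
begin

definition O_K :: "'a set" where
  "O_K = {x. absK x \<le> 1}"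

definition P_K :: "'a set" where
  "P_K = {x. absK x < 1}"

definition residue_classes :: "'a set set" where
  "residue_classes = O_K // {(x, y). x \<in> O_K \<and> y \<in> O_K \<and> x - y \<in> P_K}"

end

text \<open>
  Since \<open>card\<close> of an infinite set is 0 and \<open>0 powi N \<in> {0, 1}\<close>, \<open>range_absK\<close> together with
  non-discreteness (class \<open>perfect_space\<close>) forces the residue field to be finite.
  The measure \<open>haar\<close> is part of the structure of the class, but it is determined by its three
  axioms: \<open>K\<close> is second countable, so a translation invariant Borel measure with \<open>haar O_K = 1\<close>
  is automatically finite on compact sets and regular, i.e. it is the normalized Haar measure.
\<close>

class local_field = valued_field + perfect_space +
  fixes haar :: "'a measure"
  assumes locally_compact: "\<exists>U C. open U \<and> compact C \<and> x \<in> U \<and> U \<subseteq> C"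
    and totally_disconnected: "connected S \<Longrightarrow> x \<in> S \<Longrightarrow> y \<in> S \<Longrightarrow> x = y"
    and range_absK: "absK ` (- {0}) = range (\<lambda>N :: int. real (card residue_classes) powi N)"
    and sets_haar_sigma: "sets haar = sigma_sets UNIV {S. open S}"
    and emeasure_haar_translate: "S \<in> sets haar \<Longrightarrow> emeasure haar ((+) a ` S) = emeasure haar S"
    and emeasure_haar_O: "emeasure haar O_K = 1"

definition residue_card :: "'a::local_field itself \<Rightarrow> nat" where
  "residue_card _ = card (residue_classes :: 'a set set)"


section \<open>Operators on complex inner product spaces\<close>

text \<open>The complex inner product is linear in the first argument; its real part is the
  library's real inner product, so norm, topology and boundedness are those of the library.\<close>

class complex_inner = real_inner +
  fixes scaleC :: "complex \<Rightarrow> 'a \<Rightarrow> 'a"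
    and cinner :: "'a \<Rightarrow> 'a \<Rightarrow> complex"
  assumes scaleC_add_right: "scaleC a (x + y) = scaleC a x + scaleC a y"
    and scaleC_add_left: "scaleC (a + b) x = scaleC a x + scaleC b x"
    and scaleC_scaleC: "scaleC a (scaleC b x) = scaleC (a * b) x"
    and scaleR_scaleC: "scaleR r x = scaleC (complex_of_real r) x"
    and cinner_commute: "cinner x y = cnj (cinner y x)"
    and cinner_add_left: "cinner (x + y) z = cinner x z + cinner y z"
    and cinner_scaleC_left: "cinner (scaleC a x) y = a * cinner x y"
    and inner_eq_Re_cinner: "inner x y = Re (cinner x y)"

global_interpretation complex_vector: vector_space "scaleC :: complex \<Rightarrow> 'a \<Rightarrow> 'a::complex_inner"
  defines csubspace = complex_vector.subspace
    and cspan = complex_vector.span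
    and cdim = complex_vector.dim
proof
  show "scaleC 1 x = x" for x :: 'a
    using scaleR_scaleC[of 1 x] by simp
qed (simp_all add: scaleC_add_right scaleC_add_left scaleC_scaleC)

definition bounded_clinear :: "('h::complex_inner \<Rightarrow> 'h) \<Rightarrow> bool" where
  "bounded_clinear A \<longleftrightarrow> bounded_linear A \<and> (\<forall>c x. A (scaleC c x) = scaleC c (A x))"

definition compact_operator :: "('h::complex_inner \<Rightarrow> 'h) \<Rightarrow> bool" where
  "compact_operator A \<longleftrightarrow> bounded_clinear A \<and> compact (closure (A ` cball 0 1))"

definition op_spectrum :: "('h::complex_inner \<Rightarrow> 'h) \<Rightarrow> complex set" where
  "op_spectrum A =
    {l. \<not> (\<exists>B. bounded_clinear B \<and>
             (\<forall>x. B (A x - scaleC l x) = x) \<and> (\<forall>x. A (B x) - scaleC l (B x) = x))}"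

definition volterra_operator :: "('h::complex_inner \<Rightarrow> 'h) \<Rightarrow> bool" where
  "volterra_operator A \<longleftrightarrow> compact_operator A \<and> op_spectrum A = {0}"

definition cadjoint :: "('h::complex_inner \<Rightarrow> 'h) \<Rightarrow> 'h \<Rightarrow> 'h" where
  "cadjoint A = (THE B. \<forall>x y. cinner (A x) y = cinner x (B y))"

text \<open>Subspaces are closed, and nontrivial means nonzero: the whole space is not excluded.\<close>

definition simple_operator :: "('h::complex_inner \<Rightarrow> 'h) \<Rightarrow> bool" where
  "simple_operator A \<longleftrightarrow>
    \<not> (\<exists>M. csubspace M \<and> closed M \<and> M \<noteq> {0} \<and>
           A ` M \<subseteq> M \<and> cadjoint A ` M \<subseteq> M \<and> (\<forall>x\<in>M. A x = cadjoint A x))"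

definition imaginary_part :: "('h::complex_inner \<Rightarrow> 'h) \<Rightarrow> 'h \<Rightarrow> 'h" where
  "imaginary_part A = (\<lambda>x. scaleC (1 / (2 * \<i>)) (A x - cadjoint A x))"

text \<open>\<open>cdim\<close> is 0 on infinite-dimensional spaces, so this is the rank only for operators of
  finite rank; the value 2 is not ambiguous.\<close>

definition op_rank :: "('h::complex_inner \<Rightarrow> 'h) \<Rightarrow> nat" where
  "op_rank A = cdim (range A)"

definition orthonormal_basis :: "'h::complex_inner set \<Rightarrow> bool" where
  "orthonormal_basis E \<longleftrightarrow>
    (\<forall>e\<in>E. \<forall>f\<in>E. cinner e f = (if e = f then 1 else 0)) \<and> closure (cspan E) = UNIV"

text \<open>The first conjunct excludes vacuity, as the class does not require completeness.\<close>

definition has_trace :: "('h::complex_inner \<Rightarrow> 'h) \<Rightarrow> complex \<Rightarrow> bool" where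
  "has_trace A t \<longleftrightarrow>
    (\<exists>E :: 'h set. orthonormal_basis E) \<and>
    (\<forall>E. orthonormal_basis E \<longrightarrow> ((\<lambda>e. cinner (A e) e) has_sum t) E)"


section \<open>Basic facts about the Haar measure\<close>

lemma sets_haar [measurable_cong, simp]: "sets (haar :: 'a::local_field measure) = sets borel"
  by (simp add: sets_haar_sigma borel_def)

lemma space_haar [simp]: "space (haar :: 'a::local_field measure) = UNIV"
  using sets_eq_imp_space_eq[OF sets_haar] by simp

lemma absK_1 [simp]: "absK (1 :: 'a::valued_field) = 1"
proof -
  have "absK (1 :: 'a) * absK (1 :: 'a) = absK (1 :: 'a)" "absK (1 :: 'a) \<noteq> 0"
    by (simp_all add: absK_eq_0_iff flip: absK_mult)
  then show ?thesis
    by simp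
qed

lemma absK_0 [simp]: "absK (0 :: 'a::valued_field) = 0"
  by (simp add: absK_eq_0_iff)

lemma absK_minus [simp]: "absK (- x) = absK (x :: 'a::valued_field)"
proof -
  have "absK (- 1 :: 'a) * absK (- 1 :: 'a) = 1"
    by (simp flip: absK_mult)
  then have "absK (- 1 :: 'a) = 1"
    using absK_nonneg[of "- 1 :: 'a"] by (simp add: square_eq_1_iff)
  then show ?thesis
    using absK_mult[of "- 1" x] by simp
qed

lemma absK_minus_commute: "absK (x - y) = absK (y - x :: 'a::valued_field)"
  using absK_minus[of "x - y"] by simp

lemma absK_power: "absK (x ^ n) = absK (x :: 'a::valued_field) ^ n"
  by (induction n) (simp_all add: absK_mult)

lemma absK_add_eq: "absK y < absK x \<Longrightarrow> absK (x + y) = absK (x :: 'a::valued_field)"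
  using absK_add_le_max[of x y] absK_add_le_max[of "x + y" "- y"] by (simp add: max_def split: if_splits)

lemma open_radial:
  fixes V :: "real set"
  shows "open {x :: 'a::valued_field. x \<noteq> 0 \<and> absK x \<in> V}"
  unfolding open_iff_absK
proof (intro ballI)
  fix x :: 'a assume x: "x \<in> {x. x \<noteq> 0 \<and> absK x \<in> V}"
  have "y \<in> {x. x \<noteq> 0 \<and> absK x \<in> V}" if "absK (y - x) < absK x" for y
    using absK_add_eq[OF that] x absK_eq_0_iff[of y] absK_eq_0_iff[of x] by auto
  moreover have "absK x > 0"
    using x absK_nonneg[of x] absK_eq_0_iff[of x] by (simp add: less_le)
  ultimately show "\<exists>e>0. \<forall>y. absK (y - x) < e \<longrightarrow> y \<in> {x. x \<noteq> 0 \<and> absK x \<in> V}"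
    by blast
qed

lemma borel_absK [measurable]: "(absK :: 'a::valued_field \<Rightarrow> real) \<in> borel_measurable borel"
proof (rule measurableI)
  fix V :: "real set"
  have "{x::'a. absK x \<in> V} = {x. x \<noteq> 0 \<and> absK x \<in> V} \<union> (if 0 \<in> V then {0} else {})"
    by auto
  also have "\<dots> \<in> sets borel"
    by (intro sets.Un borel_open[OF open_radial]) auto
  finally show "absK -` V \<inter> space borel \<in> sets (borel :: 'a measure)"
    by (simp add: vimage_def)
qed simp

lemma O_K_borel [measurable, simp]: "O_K \<in> sets (borel :: 'a::valued_field measure)"
  unfolding O_K_def by measurable

definition radial_on_O :: "('a::local_field \<Rightarrow> complex) \<Rightarrow> bool" where
  "radial_on_O u \<longleftrightarrow> (\<forall>x\<in>O_K. \<forall>y\<in>O_K. absK x = absK y \<longrightarrow> u x = u y)"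

definition square_integrable_on_O :: "('a::local_field \<Rightarrow> complex) \<Rightarrow> bool" where
  "square_integrable_on_O u \<longleftrightarrow>
    set_borel_measurable haar O_K u \<and> set_integrable haar O_K (\<lambda>x. (cmod (u x))\<^sup>2)"

lemma radial_measurable:
  assumes "radial_on_O (u :: 'a::local_field \<Rightarrow> complex)"
  shows "set_borel_measurable haar O_K u"
  unfolding set_borel_measurable_def
proof (rule measurableI)
  fix V :: "complex set" assume V: "V \<in> sets borel"
  define g where "g x = indicator O_K x *\<^sub>R u x" for x :: 'a
  have rad: "g x = g y" if "absK x = absK y" for x y :: 'a
  proof (cases "x \<in> O_K")
    case True
    then have "y \<in> O_K"
      using that by (simp add: O_K_def)
    then have "u x = u y"
      using assms True that unfolding radial_on_O_def by blast
    then show ?thesis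
      using True \<open>y \<in> O_K\<close> by (simp add: g_def)
  next
    case False
    then have "y \<notin> O_K"
      using that by (simp add: O_K_def)
    then show ?thesis
      using False by (simp add: g_def)
  qed
  have "g -` V = {x. x \<noteq> 0 \<and> absK x \<in> absK ` (g -` V)} \<union> (if 0 \<in> g -` V then {0} else {})"
  proof (intro set_eqI iffI)
    fix x :: 'a assume "x \<in> g -` V"
    then show "x \<in> {x. x \<noteq> 0 \<and> absK x \<in> absK ` (g -` V)} \<union> (if 0 \<in> g -` V then {0} else {})"
      by auto
  next
    fix x :: 'a assume x: "x \<in> {x. x \<noteq> 0 \<and> absK x \<in> absK ` (g -` V)} \<union> (if 0 \<in> g -` V then {0} else {})"
    then obtain y where "y \<in> g -` V" "absK x = absK y"
      by (auto split: if_splits)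
    then show "x \<in> g -` V"
      using rad[of x y] by simp
  qed
  also have "\<dots> \<in> sets borel"
    by (intro sets.Un borel_open[OF open_radial]) auto
  finally show "(\<lambda>x. indicator O_K x *\<^sub>R u x) -` V \<inter> space haar \<in> sets haar"
    by (simp add: g_def[abs_def])
qed simp

lemma haar_fin_O: "emeasure (haar :: 'a::local_field measure) O_K < \<infinity>"
  by (simp add: emeasure_haar_O)

lemma residue_card_gt_1: "residue_card TYPE('a::local_field) > 1"
proof (rule ccontr)
  assume "\<not> ?thesis"
  then have q: "real (card (residue_classes :: 'a set set)) \<in> {0, 1}"
    unfolding residue_card_def by auto
  have "absK x = 1" if "x \<noteq> 0" for x :: 'a
  proof -
    have "absK x \<in> absK ` (- {0 :: 'a})"
      using that by simp
    then obtain N where "absK x = real (card (residue_classes :: 'a set set)) powi N"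
      unfolding range_absK by auto
    then show ?thesis
      using q that absK_eq_0_iff[of x] by (auto simp: power_int_0_left_if)
  qed
  then have "open {0 :: 'a}"
    unfolding open_iff_absK by (intro ballI exI[of _ 1]) (metis diff_zero less_irrefl singletonD singletonI zero_less_one)
  then show False
    using not_open_singleton by blast
qed

definition ball_K :: "nat \<Rightarrow> 'a::local_field set" where
  "ball_K n = {x. absK x \<le> (1 / real (residue_card TYPE('a))) ^ n}"

lemma ball_K_borel [measurable, simp]: "ball_K n \<in> sets (borel :: 'a::local_field measure)"
  unfolding ball_K_def by measurable

lemma absK_cases:
  fixes x :: "'a::local_field"
  assumes "x \<noteq> 0" "absK x \<le> 1"
  obtains n :: nat where "absK x = (1 / real (residue_card TYPE('a))) ^ n"
proof -
  let ?q = "real (residue_card TYPE('a))"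
  have q: "?q > 1"
    using residue_card_gt_1[where 'a='a] by simp
  have "absK x \<in> absK ` (- {0 :: 'a})"
    using assms by simp
  then obtain N where N: "absK x = ?q powi N"
    unfolding range_absK residue_card_def by auto
  have "N \<le> 0"
  proof (rule ccontr)
    assume "\<not> N \<le> 0"
    then have "?q powi N > 1"
      using q by (simp add: power_int_def)
    then show False
      using N assms by simp
  qed
  then have "absK x = (1 / ?q) ^ nat (- N)"
    using N by (cases "N = 0") (simp_all add: power_int_def inverse_eq_divide)
  then show ?thesis
    by (rule that)
qed

lemma absK_uniformizer:
  obtains p :: "'a::local_field" where "absK p = 1 / real (residue_card TYPE('a))"
proof -
  have "real (card (residue_classes :: 'a set set)) powi (- 1) \<in> absK ` (- {0 :: 'a})"
    unfolding range_absK by (rule rangeI)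
  then show ?thesis
    using that unfolding residue_card_def by (metis imageE inverse_eq_divide power_int_minus1_right)
qed

lemma emeasure_ball_K: "emeasure haar (ball_K n :: 'a::local_field set) \<le> ennreal ((1 / 2) ^ n)"
proof (induction n)
  case 0
  then show ?case
    using emeasure_haar_O[where 'a='a] by (simp add: ball_K_def O_K_def)
next
  case (Suc n)
  let ?q = "real (residue_card TYPE('a))"
  let ?B = "ball_K (Suc n) :: 'a set"
  have q: "?q > 1"
    using residue_card_gt_1[where 'a='a] by simp
  obtain p :: 'a where p: "absK p = 1 / ?q"
    by (rule absK_uniformizer)
  define T where "T = (+) (p ^ n) ` ?B"
  have lt: "(1 / ?q) ^ Suc n < (1 / ?q) ^ n"
    using q by (intro power_strict_decreasing) auto
  have pn: "absK (p ^ n) = (1 / ?q) ^ n"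
    by (simp only: absK_power p)
  have T: "absK x = (1 / ?q) ^ n" if "x \<in> T" for x
    using that absK_add_eq[of _ "p ^ n"] pn lt unfolding T_def ball_K_def by fastforce
  have T_eq: "T = {x. absK (x - p ^ n) \<le> (1 / ?q) ^ Suc n}"
  proof -
    have "x \<in> T" if "absK (x - p ^ n) \<le> (1 / ?q) ^ Suc n" for x
      unfolding T_def using that by (intro image_eqI[of _ _ "x - p ^ n"]) (auto simp: ball_K_def)
    then show ?thesis
      unfolding T_def by (auto simp: ball_K_def)
  qed
  have "open T"
    unfolding open_iff_absK
  proof (intro ballI exI[of _ "(1 / ?q) ^ Suc n"] conjI allI impI)
    fix x y assume "x \<in> T" "absK (y - x) < (1 / ?q) ^ Suc n"
    then show "y \<in> T"
      using absK_add_le_max[of "y - x" "x - p ^ n"] unfolding T_eq by auto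
  qed (use q in auto)
  then have T_meas: "T \<in> sets haar"
    by simp
  have disj: "T \<inter> ?B = {}"
    using T lt unfolding ball_K_def by force
  have sub: "T \<union> ?B \<subseteq> ball_K n"
    using T lt unfolding ball_K_def by fastforce
  have "2 * emeasure haar ?B = emeasure haar T + emeasure haar ?B"
    unfolding T_def by (simp add: emeasure_haar_translate mult_2)
  also have "\<dots> = emeasure haar (T \<union> ?B)"
    using disj T_meas by (intro plus_emeasure) auto
  also have "\<dots> \<le> emeasure haar (ball_K n :: 'a set)"
    using sub by (intro emeasure_mono) auto
  also have "\<dots> \<le> ennreal ((1 / 2) ^ n)"
    by (rule Suc)
  finally have *: "2 * emeasure haar ?B \<le> ennreal ((1 / 2) ^ n)" .
  have "emeasure haar ?B \<noteq> \<infinity>"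
    using * by (auto simp: top_unique ennreal_mult_eq_top_iff)
  then obtain r where r: "r \<ge> 0" "emeasure haar ?B = ennreal r"
    by (cases "emeasure haar ?B") auto
  have "ennreal (2 * r) \<le> ennreal ((1 / 2) ^ n)"
    using * r by (simp add: ennreal_mult)
  then have "2 * r \<le> (1 / 2) ^ n"
    by (subst (asm) ennreal_le_iff) auto
  then show ?case
    using r by (simp add: ennreal_leI)
qed

lemma AE_haar_nonzero: "AE x in haar. x \<noteq> (0 :: 'a::local_field)"
proof -
  have "emeasure haar {0 :: 'a} \<le> ennreal ((1 / 2) ^ n)" for n
  proof -
    have "emeasure haar {0 :: 'a} \<le> emeasure haar (ball_K n :: 'a set)"
      by (intro emeasure_mono) (auto simp: ball_K_def)
    then show ?thesis
      using emeasure_ball_K by (rule order_trans)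
  qed
  moreover have "(\<lambda>n. ennreal ((1 / 2) ^ n)) \<longlonglongrightarrow> ennreal 0"
    by (intro tendsto_ennrealI LIMSEQ_realpow_zero) auto
  ultimately have "emeasure haar {0 :: 'a} \<le> 0"
    by (metis LIMSEQ_le_const ennreal_0)
  then show ?thesis
    by (intro AE_I[of _ _ "{0}"]) auto
qed

lemma integrable_ln_absK:
  "set_integrable haar O_K (\<lambda>x :: 'a::local_field. (ln (absK x))\<^sup>2)"
proof -
  let ?q = "real (residue_card TYPE('a))"
  let ?c = "\<lambda>n. (real n * ln ?q)\<^sup>2"
  have q: "?q > 1"
    using residue_card_gt_1[where 'a='a] by simp
  have pw: "ennreal (indicator O_K x *\<^sub>R (ln (absK x))\<^sup>2) \<le> (\<Sum>n. ennreal (?c n) * indicator (ball_K n) x)"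
    for x :: 'a
  proof (cases "x \<in> O_K \<and> x \<noteq> 0")
    case True
    then obtain n where n: "absK x = (1 / ?q) ^ n"
      using absK_cases[of x] by (auto simp: O_K_def)
    have "(ln (absK x))\<^sup>2 = ?c n"
      using q by (simp add: n ln_realpow ln_div power2_eq_square)
    moreover have "x \<in> ball_K n"
      by (simp add: ball_K_def n)
    ultimately have "ennreal (indicator O_K x *\<^sub>R (ln (absK x))\<^sup>2) = ennreal (?c n) * indicator (ball_K n) x"
      using True by simp
    also have "\<dots> \<le> (\<Sum>n. ennreal (?c n) * indicator (ball_K n) x)"
      using sum_le_suminf[of "\<lambda>n. ennreal (?c n) * indicator (ball_K n) x" "{n}"]
      by (simp del: sum_mult_indicator)
    finally show ?thesis .
  qed auto
  have "(\<integral>\<^sup>+x. ennreal (indicator O_K x *\<^sub>R (ln (absK x))\<^sup>2) \<partial>(haar :: 'a measure)) \<le>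
      (\<integral>\<^sup>+x. (\<Sum>n. ennreal (?c n) * indicator (ball_K n) x) \<partial>(haar :: 'a measure))"
    by (intro nn_integral_mono pw)
  also have "\<dots> = (\<Sum>n. ennreal (?c n) * emeasure haar (ball_K n :: 'a set))"
    by (subst nn_integral_suminf) (auto simp: nn_integral_cmult_indicator)
  also have "\<dots> \<le> (\<Sum>n. ennreal (?c n * (1 / 2) ^ n))"
    using emeasure_ball_K by (intro suminf_le) (auto simp: ennreal_mult intro!: mult_left_mono)
  also have "\<dots> < \<infinity>"
  proof -
    have "summable (\<lambda>n. (real n)\<^sup>2 * (1 / 2) ^ n)"
    proof (rule summable_ratio_test[of "9 / 10" 3])
      fix n :: nat assume "n \<ge> 3"
      then have n: "real n \<ge> 3"
        by simp
      have 3: "3 * real n \<le> real n * real n"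
        using n by (intro mult_right_mono) auto
      have "(real (Suc n))\<^sup>2 = real n * real n + 2 * real n + 1"
        by (simp add: power2_eq_square algebra_simps)
      with 3 n have "(real (Suc n))\<^sup>2 \<le> 9 / 5 * (real n)\<^sup>2"
        unfolding power2_eq_square by linarith
      then have "(real (Suc n))\<^sup>2 * (1 / 2) ^ Suc n \<le> 9 / 5 * (real n)\<^sup>2 * (1 / 2) ^ Suc n"
        by (intro mult_right_mono) auto
      then show "norm ((real (Suc n))\<^sup>2 * (1 / 2) ^ Suc n) \<le> 9 / 10 * norm ((real n)\<^sup>2 * (1 / 2) ^ n)"
        by (simp add: norm_mult norm_power)
    qed simp
    then have "summable (\<lambda>n. ?c n * (1 / 2) ^ n)"
      using summable_mult[of "\<lambda>n. (real n)\<^sup>2 * (1 / 2) ^ n" "(ln ?q)\<^sup>2"]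
      by (simp add: power_mult_distrib mult_ac)
    then show ?thesis
      by (subst suminf_ennreal2) auto
  qed
  finally show ?thesis
    unfolding set_integrable_def
    by (intro integrableI_nonneg) auto
qed

lemma square_integrable_on_OI:
  fixes u :: "'a::local_field \<Rightarrow> complex"
  assumes "set_borel_measurable haar O_K u" "set_integrable haar O_K g"
    and "AE x in haar. x \<in> O_K \<longrightarrow> (cmod (u x))\<^sup>2 \<le> g x"
  shows "square_integrable_on_O u"
proof -
  let ?u = "\<lambda>x. indicator O_K x *\<^sub>R u x"
  have [measurable]: "?u \<in> borel_measurable haar"
    using assms(1) by (simp add: set_borel_measurable_def)
  have "integrable haar (\<lambda>x. indicator O_K x *\<^sub>R (cmod (u x))\<^sup>2)"
  proof (rule Bochner_Integration.integrable_bound)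
    show "integrable haar (\<lambda>x. indicator O_K x *\<^sub>R g x)"
      using assms(2) by (simp add: set_integrable_def)
    have "(\<lambda>x. indicator O_K x *\<^sub>R (cmod (u x))\<^sup>2) = (\<lambda>x. (cmod (?u x))\<^sup>2)"
      by (auto simp: indicator_def)
    then show "(\<lambda>x. indicator O_K x *\<^sub>R (cmod (u x))\<^sup>2) \<in> borel_measurable haar"
      by (rule ssubst) measurable
    show "AE x in haar. norm (indicator O_K x *\<^sub>R (cmod (u x))\<^sup>2) \<le> norm (indicator O_K x *\<^sub>R g x)"
      using assms(3) by eventually_elim (auto simp: indicator_def)
  qed
  then show ?thesis
    using assms(1) by (simp add: square_integrable_on_O_def set_integrable_def)
qed

lemma set_measurable_pair:
  fixes u v :: "'a::local_field \<Rightarrow> complex"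
  assumes "set_borel_measurable haar O_K u" "set_borel_measurable haar O_K v"
  shows "set_borel_measurable haar O_K (\<lambda>x. u x + v x)"
    and "set_borel_measurable haar O_K (\<lambda>x. u x * cnj (v x))"
proof -
  let ?u = "\<lambda>x. indicator O_K x *\<^sub>R u x" and ?v = "\<lambda>x. indicator O_K x *\<^sub>R v x"
  have [measurable]: "?u \<in> borel_measurable haar" "?v \<in> borel_measurable haar"
    using assms by (simp_all add: set_borel_measurable_def)
  have [measurable]: "(\<lambda>x. cnj (?v x)) \<in> borel_measurable haar"
    by (rule borel_measurable_continuous_on[OF continuous_on_cnj[OF continuous_on_id]]) measurable
  have "(\<lambda>x. indicator O_K x *\<^sub>R (u x + v x)) = (\<lambda>x. ?u x + ?v x)"
    by (simp add: scaleR_add_right)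
  then show "set_borel_measurable haar O_K (\<lambda>x. u x + v x)"
    unfolding set_borel_measurable_def by (rule ssubst) measurable
  have "(\<lambda>x. indicator O_K x *\<^sub>R (u x * cnj (v x))) = (\<lambda>x. ?u x * cnj (?v x))"
    by (auto simp: indicator_def)
  then show "set_borel_measurable haar O_K (\<lambda>x. u x * cnj (v x))"
    unfolding set_borel_measurable_def by (rule ssubst) measurable
qed

lemma square_integrable_add:
  assumes "square_integrable_on_O u" "square_integrable_on_O v"
  shows "square_integrable_on_O (\<lambda>x. u x + v x)"
proof (rule square_integrable_on_OI)
  show "set_borel_measurable haar O_K (\<lambda>x. u x + v x)"
    using assms by (intro set_measurable_pair) (simp_all add: square_integrable_on_O_def)
  show "set_integrable haar O_K (\<lambda>x. 2 * (cmod (u x))\<^sup>2 + 2 * (cmod (v x))\<^sup>2)"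
    using assms unfolding square_integrable_on_O_def
    by (intro set_integral_add set_integrable_mult_right) auto
  have "(cmod (a + b))\<^sup>2 \<le> 2 * (cmod a)\<^sup>2 + 2 * (cmod b)\<^sup>2" for a b
  proof -
    have "(cmod (a + b))\<^sup>2 \<le> (cmod a + cmod b)\<^sup>2"
      by (intro power_mono norm_triangle_ineq) simp
    also have "\<dots> \<le> 2 * (cmod a)\<^sup>2 + 2 * (cmod b)\<^sup>2"
      using zero_le_power2[of "cmod a - cmod b"] by (simp add: power2_eq_square algebra_simps)
    finally show ?thesis .
  qed
  then show "AE x in haar. x \<in> O_K \<longrightarrow> (cmod (u x + v x))\<^sup>2 \<le> 2 * (cmod (u x))\<^sup>2 + 2 * (cmod (v x))\<^sup>2"
    by simp
qed

lemma square_integrable_mult: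
  assumes "square_integrable_on_O u"
  shows "square_integrable_on_O (\<lambda>x. c * u x)"
proof (rule square_integrable_on_OI)
  have "(\<lambda>x. c * (indicator O_K x *\<^sub>R u x)) \<in> borel_measurable haar"
    using assms by (intro borel_measurable_times)
      (simp_all add: square_integrable_on_O_def set_borel_measurable_def)
  then show "set_borel_measurable haar O_K (\<lambda>x. c * u x)"
    by (simp add: set_borel_measurable_def)
  show "set_integrable haar O_K (\<lambda>x. (cmod c)\<^sup>2 * (cmod (u x))\<^sup>2)"
    using assms unfolding square_integrable_on_O_def by (intro set_integrable_mult_right) auto
qed (simp add: norm_mult power_mult_distrib)

lemma mult_le_sum_squares: "a * b \<le> a\<^sup>2 + b\<^sup>2" for a b :: real
proof -
  have "2 * (a * b) \<le> a\<^sup>2 + b\<^sup>2"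
    using zero_le_power2[of "a - b"] by (simp add: power2_eq_square algebra_simps)
  then show ?thesis
    using zero_le_power2[of a] zero_le_power2[of b] by linarith
qed

lemma integrable_mult_cnj:
  assumes "square_integrable_on_O u" "square_integrable_on_O v"
  shows "set_integrable haar O_K (\<lambda>x. u x * cnj (v x))"
  unfolding set_integrable_def
proof (rule Bochner_Integration.integrable_bound)
  show "integrable haar (\<lambda>x. indicator O_K x *\<^sub>R ((cmod (u x))\<^sup>2 + (cmod (v x))\<^sup>2))"
    using assms set_integral_add(1) unfolding square_integrable_on_O_def set_integrable_def[symmetric]
    by blast
  show "(\<lambda>x. indicator O_K x *\<^sub>R (u x * cnj (v x))) \<in> borel_measurable haar"
    using assms set_measurable_pair(2)
    unfolding square_integrable_on_O_def set_borel_measurable_def[symmetric] by blast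
  show "AE x in haar. norm (indicator O_K x *\<^sub>R (u x * cnj (v x)))
      \<le> norm (indicator O_K x *\<^sub>R ((cmod (u x))\<^sup>2 + (cmod (v x))\<^sup>2))"
    using mult_le_sum_squares by (auto simp: indicator_def norm_mult)
qed


section \<open>The space of radial square integrable functions\<close>

text \<open>Only the values on \<open>O_K\<close> matter; functions are identified when they agree almost everywhere
  on \<open>O_K\<close>.\<close>

definition radial_L2_fun :: "('a::local_field \<Rightarrow> complex) \<Rightarrow> bool" where
  "radial_L2_fun u \<longleftrightarrow> radial_on_O u \<and> square_integrable_on_O u"

definition radial_L2_rel :: "('a::local_field \<Rightarrow> complex) \<Rightarrow> ('a \<Rightarrow> complex) \<Rightarrow> bool" where
  "radial_L2_rel u v \<longleftrightarrow>
    radial_L2_fun u \<and> radial_L2_fun v \<and> (AE x in haar. x \<in> O_K \<longrightarrow> u x = v x)"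

lemma radial_L2_fun_add:
  "radial_L2_fun u \<Longrightarrow> radial_L2_fun v \<Longrightarrow> radial_L2_fun (\<lambda>x. u x + v x)"
  unfolding radial_L2_fun_def radial_on_O_def by (metis square_integrable_add)

lemma radial_L2_fun_mult: "radial_L2_fun u \<Longrightarrow> radial_L2_fun (\<lambda>x. c * u x)"
  unfolding radial_L2_fun_def radial_on_O_def by (metis square_integrable_mult)

lemma radial_L2_fun_zero: "radial_L2_fun (\<lambda>x. 0)"
  unfolding radial_L2_fun_def radial_on_O_def square_integrable_on_O_def set_borel_measurable_def
    set_integrable_def by simp

quotient_type (overloaded) 'a radial_L2 = "'a::local_field \<Rightarrow> complex" / partial: radial_L2_rel
proof (rule part_equivpI)
  show "\<exists>u :: 'a \<Rightarrow> complex. radial_L2_rel u u"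
    using radial_L2_fun_zero by (auto simp: radial_L2_rel_def)
  show "symp (radial_L2_rel :: ('a \<Rightarrow> complex) \<Rightarrow> _)"
  proof (rule sympI)
    fix u v :: "'a \<Rightarrow> complex" assume "radial_L2_rel u v"
    then show "radial_L2_rel v u"
      unfolding radial_L2_rel_def by (auto elim!: eventually_mono)
  qed
  show "transp (radial_L2_rel :: ('a \<Rightarrow> complex) \<Rightarrow> _)"
  proof (rule transpI)
    fix u v w :: "'a \<Rightarrow> complex" assume *: "radial_L2_rel u v" "radial_L2_rel v w"
    then have "AE x in haar. x \<in> O_K \<longrightarrow> u x = v x" "AE x in haar. x \<in> O_K \<longrightarrow> v x = w x"
      by (simp_all add: radial_L2_rel_def)
    then have "AE x in haar. x \<in> O_K \<longrightarrow> u x = w x"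
      by eventually_elim auto
    then show "radial_L2_rel u w"
      using * by (simp add: radial_L2_rel_def)
  qed
qed

lift_definition radial_cinner :: "'a::local_field radial_L2 \<Rightarrow> 'a radial_L2 \<Rightarrow> complex" is
  "\<lambda>u v. LINT x:O_K|haar. u x * cnj (v x)"
proof -
  fix u u' v v' :: "'a \<Rightarrow> complex"
  assume *: "radial_L2_rel u u'" "radial_L2_rel v v'"
  then have "AE x in haar. x \<in> O_K \<longrightarrow> u x = u' x" "AE x in haar. x \<in> O_K \<longrightarrow> v x = v' x"
    by (simp_all add: radial_L2_rel_def)
  then have eq: "AE x in haar. indicator O_K x *\<^sub>R (u x * cnj (v x)) = indicator O_K x *\<^sub>R (u' x * cnj (v' x))"
    by eventually_elim (auto simp: indicator_def)
  have "set_integrable haar O_K (\<lambda>x. u x * cnj (v x))" "set_integrable haar O_K (\<lambda>x. u' x * cnj (v' x))"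
    using * by (auto simp: radial_L2_rel_def radial_L2_fun_def intro: integrable_mult_cnj)
  then show "(LINT x:O_K|haar. u x * cnj (v x)) = (LINT x:O_K|haar. u' x * cnj (v' x))"
    unfolding set_lebesgue_integral_def set_integrable_def
    using eq by (intro integral_cong_AE) (auto dest: borel_measurable_integrable)
qed

lemma radial_cinner_commute: "radial_cinner x y = cnj (radial_cinner y x)"
proof transfer
  fix u v :: "'a \<Rightarrow> complex"
  have "cnj (LINT x|haar. indicator O_K x *\<^sub>R (v x * cnj (u x)))
      = (LINT x|haar. cnj (indicator O_K x *\<^sub>R (v x * cnj (u x))))"
    by (rule Bochner_Integration.integral_cnj[symmetric])
  also have "\<dots> = (LINT x|haar. indicator O_K x *\<^sub>R (u x * cnj (v x)))"
    by (intro Bochner_Integration.integral_cong) (auto simp: indicator_def)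
  finally show "(LINT x:O_K|haar. u x * cnj (v x)) = cnj (LINT x:O_K|haar. v x * cnj (u x))"
    unfolding set_lebesgue_integral_def by simp
qed

lemma radial_cinner_self:
  fixes u :: "'a::local_field \<Rightarrow> complex"
  shows "(LINT x:O_K|haar. u x * cnj (u x)) = complex_of_real (LINT x:O_K|haar. (cmod (u x))\<^sup>2)"
proof -
  have "(LINT x:O_K|haar. u x * cnj (u x)) = (LINT x:O_K|haar. complex_of_real ((cmod (u x))\<^sup>2))"
    by (simp only: complex_norm_square)
  also have "\<dots> = complex_of_real (LINT x:O_K|haar. (cmod (u x))\<^sup>2)"
    by (rule set_integral_complex_of_real)
  finally show ?thesis .
qed

lemma radial_square_integral_eq_0_iff:
  fixes u :: "'a::local_field \<Rightarrow> complex"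
  assumes "square_integrable_on_O u"
  shows "(LINT x:O_K|haar. (cmod (u x))\<^sup>2) = 0 \<longleftrightarrow> (AE x in haar. x \<in> O_K \<longrightarrow> u x = 0)"
proof -
  have "(LINT x:O_K|haar. (cmod (u x))\<^sup>2) = 0
      \<longleftrightarrow> (AE x in haar. indicator O_K x *\<^sub>R (cmod (u x))\<^sup>2 = 0)"
    unfolding set_lebesgue_integral_def using assms
    by (intro integral_nonneg_eq_0_iff_AE) (auto simp: square_integrable_on_O_def set_integrable_def)
  also have "\<dots> \<longleftrightarrow> (AE x in haar. x \<in> O_K \<longrightarrow> u x = 0)"
    by (intro AE_cong) (auto simp: indicator_def)
  finally show ?thesis .
qed

lift_definition radial_scaleC :: "complex \<Rightarrow> 'a::local_field radial_L2 \<Rightarrow> 'a radial_L2" is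
  "\<lambda>c u x. c * u x"
proof -
  fix c and u u' :: "'a \<Rightarrow> complex"
  assume *: "radial_L2_rel u u'"
  then have "AE x in haar. x \<in> O_K \<longrightarrow> u x = u' x"
    by (simp add: radial_L2_rel_def)
  then have "AE x in haar. x \<in> O_K \<longrightarrow> c * u x = c * u' x"
    by eventually_elim auto
  then show "radial_L2_rel (\<lambda>x. c * u x) (\<lambda>x. c * u' x)"
    using * by (simp add: radial_L2_rel_def radial_L2_fun_mult)
qed

instantiation radial_L2 :: (local_field) ab_group_add
begin

lift_definition zero_radial_L2 :: "'a radial_L2" is "\<lambda>x. 0"
  using radial_L2_fun_zero by (auto simp: radial_L2_rel_def)

lift_definition plus_radial_L2 :: "'a radial_L2 \<Rightarrow> 'a radial_L2 \<Rightarrow> 'a radial_L2" is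
  "\<lambda>u v x. u x + v x"
proof -
  fix u u' v v' :: "'a \<Rightarrow> complex"
  assume *: "radial_L2_rel u u'" "radial_L2_rel v v'"
  then have "AE x in haar. x \<in> O_K \<longrightarrow> u x = u' x" "AE x in haar. x \<in> O_K \<longrightarrow> v x = v' x"
    by (simp_all add: radial_L2_rel_def)
  then have "AE x in haar. x \<in> O_K \<longrightarrow> u x + v x = u' x + v' x"
    by eventually_elim auto
  then show "radial_L2_rel (\<lambda>x. u x + v x) (\<lambda>x. u' x + v' x)"
    using * by (simp add: radial_L2_rel_def radial_L2_fun_add)
qed

definition uminus_radial_L2 :: "'a radial_L2 \<Rightarrow> 'a radial_L2" where
  "uminus_radial_L2 f = radial_scaleC (- 1) f"

definition minus_radial_L2 :: "'a radial_L2 \<Rightarrow> 'a radial_L2 \<Rightarrow> 'a radial_L2" where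
  "minus_radial_L2 f g = f + - g"

instance
proof
  fix f g h :: "'a radial_L2"
  show "f + g + h = f + (g + h)"
    by transfer (simp add: radial_L2_rel_def add.assoc radial_L2_fun_add)
  show "f + g = g + f"
    by transfer (simp add: radial_L2_rel_def add.commute radial_L2_fun_add)
  show "0 + f = f"
    by transfer (simp add: radial_L2_rel_def)
  show "- f + f = 0"
    unfolding uminus_radial_L2_def
    by transfer (simp add: radial_L2_rel_def radial_L2_fun_zero)
  show "f - g = f + - g"
    by (rule minus_radial_L2_def)
qed

end

lemma radial_scaleC:
  "radial_scaleC a (f + g) = radial_scaleC a f + radial_scaleC a g"
  "radial_scaleC (a + b) f = radial_scaleC a f + radial_scaleC b f"
  "radial_scaleC a (radial_scaleC b f) = radial_scaleC (a * b) f"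
  "radial_scaleC 1 f = f"
  by (transfer; simp add: radial_L2_rel_def distrib_left distrib_right mult.assoc
      radial_L2_fun_add radial_L2_fun_mult)+

lemma radial_cinner_add:
  "radial_cinner (f + g) h = radial_cinner f h + radial_cinner g h"
proof transfer
  fix u v w :: "'a \<Rightarrow> complex"
  assume "radial_L2_rel u u" "radial_L2_rel v v" "radial_L2_rel w w"
  then have "set_integrable haar O_K (\<lambda>x. u x * cnj (w x))" "set_integrable haar O_K (\<lambda>x. v x * cnj (w x))"
    by (auto simp: radial_L2_rel_def radial_L2_fun_def intro: integrable_mult_cnj)
  then show "(LINT x:O_K|haar. (u x + v x) * cnj (w x))
      = (LINT x:O_K|haar. u x * cnj (w x)) + (LINT x:O_K|haar. v x * cnj (w x))"
    by (simp add: distrib_right set_integral_add)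
qed

lemma radial_cinner_scale: "radial_cinner (radial_scaleC a f) g = a * radial_cinner f g"
  by transfer (simp add: mult.assoc)

lemma radial_cinner_pos:
  "Re (radial_cinner f f) \<ge> 0 \<and> (Re (radial_cinner f f) = 0 \<longleftrightarrow> f = 0)"
proof transfer
  fix u :: "'a \<Rightarrow> complex" assume "radial_L2_rel u u"
  then have u: "radial_L2_fun u"
    by (simp add: radial_L2_rel_def)
  have "0 \<le> (LINT x:O_K|haar. (cmod (u x))\<^sup>2)"
    unfolding set_lebesgue_integral_def by (intro integral_nonneg_AE) auto
  moreover have "radial_L2_rel u (\<lambda>x. 0) \<longleftrightarrow> (LINT x:O_K|haar. (cmod (u x))\<^sup>2) = 0"
    using u by (simp add: radial_L2_rel_def radial_L2_fun_zero radial_L2_fun_def radial_square_integral_eq_0_iff)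
  ultimately show "0 \<le> Re (LINT x:O_K|haar. u x * cnj (u x)) \<and>
      (Re (LINT x:O_K|haar. u x * cnj (u x)) = 0 \<longleftrightarrow> radial_L2_rel u (\<lambda>x. 0))"
    by (simp only: radial_cinner_self Re_complex_of_real)
qed

instantiation radial_L2 :: (local_field) real_vector
begin

definition scaleR_radial_L2 :: "real \<Rightarrow> 'a radial_L2 \<Rightarrow> 'a radial_L2" where
  "scaleR_radial_L2 r f = radial_scaleC (complex_of_real r) f"

instance
proof
  fix f g :: "'a radial_L2" and r s :: real
  show "r *\<^sub>R (f + g) = r *\<^sub>R f + r *\<^sub>R g" "(r + s) *\<^sub>R f = r *\<^sub>R f + s *\<^sub>R f"
    "r *\<^sub>R s *\<^sub>R f = (r * s) *\<^sub>R f" "1 *\<^sub>R f = f"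
    by (simp_all add: scaleR_radial_L2_def radial_scaleC)
qed

end

instantiation radial_L2 :: (local_field) complex_inner
begin

definition scaleC_radial_L2 :: "complex \<Rightarrow> 'a radial_L2 \<Rightarrow> 'a radial_L2" where
  "scaleC_radial_L2 = radial_scaleC"

definition cinner_radial_L2 :: "'a radial_L2 \<Rightarrow> 'a radial_L2 \<Rightarrow> complex" where
  "cinner_radial_L2 = radial_cinner"

definition inner_radial_L2 :: "'a radial_L2 \<Rightarrow> 'a radial_L2 \<Rightarrow> real" where
  "inner_radial_L2 f g = Re (radial_cinner f g)"

definition norm_radial_L2 :: "'a radial_L2 \<Rightarrow> real" where
  "norm_radial_L2 f = sqrt (inner f f)"

definition dist_radial_L2 :: "'a radial_L2 \<Rightarrow> 'a radial_L2 \<Rightarrow> real" where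
  "dist_radial_L2 f g = norm (f - g)"

definition sgn_radial_L2 :: "'a radial_L2 \<Rightarrow> 'a radial_L2" where
  "sgn_radial_L2 f = inverse (norm f) *\<^sub>R f"

definition uniformity_radial_L2 :: "('a radial_L2 \<times> 'a radial_L2) filter" where
  "uniformity_radial_L2 = (INF e\<in>{0<..}. principal {(f, g). dist f g < e})"

definition open_radial_L2 :: "'a radial_L2 set \<Rightarrow> bool" where
  "open_radial_L2 S \<longleftrightarrow> (\<forall>f\<in>S. \<forall>\<^sub>F (f', g) in uniformity. f' = f \<longrightarrow> g \<in> S)"

instance
proof
  fix f g h :: "'a radial_L2" and a b :: complex and r :: real
  show "sgn f = f /\<^sub>R norm f"
    by (rule sgn_radial_L2_def)
  show "dist f g = norm (f - g)"
    by (rule dist_radial_L2_def)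
  show "uniformity = (INF e\<in>{0<..}. principal {(f, g :: 'a radial_L2). dist f g < e})"
    by (rule uniformity_radial_L2_def)
  show "open U \<longleftrightarrow> (\<forall>f\<in>U. \<forall>\<^sub>F (f', g) in uniformity. f' = f \<longrightarrow> g \<in> U)" for U :: "'a radial_L2 set"
    by (rule open_radial_L2_def)
  show "inner f g = inner g f"
    unfolding inner_radial_L2_def by (subst radial_cinner_commute) simp
  show "inner (f + g) h = inner f h + inner g h" "inner (r *\<^sub>R f) g = r * inner f g"
    "0 \<le> inner f f" "inner f f = 0 \<longleftrightarrow> f = 0"
    using radial_cinner_pos[of f]
    by (simp_all add: inner_radial_L2_def radial_cinner_add radial_cinner_scale scaleR_radial_L2_def)
  show "norm f = sqrt (inner f f)"
    by (rule norm_radial_L2_def)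
  show "scaleC a (f + g) = scaleC a f + scaleC a g" "scaleC (a + b) f = scaleC a f + scaleC b f"
    "scaleC a (scaleC b f) = scaleC (a * b) f" "r *\<^sub>R f = scaleC (complex_of_real r) f"
    unfolding scaleC_radial_L2_def by (fact radial_scaleC scaleR_radial_L2_def)+
  show "cinner f g = cnj (cinner g f)" "cinner (f + g) h = cinner f h + cinner g h"
    "cinner (scaleC a f) g = a * cinner f g" "inner f g = Re (cinner f g)"
    unfolding cinner_radial_L2_def scaleC_radial_L2_def
    by (fact radial_cinner_commute radial_cinner_add radial_cinner_scale inner_radial_L2_def)+
qed

end


section \<open>The integration operator\<close>

definition I01_fun :: "('a::local_field \<Rightarrow> complex) \<Rightarrow> 'a \<Rightarrow> complex" where
  "I01_fun u x =
    complex_of_real ((1 - real (residue_card TYPE('a))) /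
        (real (residue_card TYPE('a)) * ln (real (residue_card TYPE('a))))) *
    (LINT y:{y. absK y < absK x}|haar. complex_of_real (ln (absK x) - ln (absK y)) * u y)"

lemma I01_integral_bound:
  fixes u :: "'a::local_field \<Rightarrow> complex"
  assumes u: "square_integrable_on_O u" and x: "x \<in> O_K"
  defines "h \<equiv> \<lambda>y. indicator {y. absK y < absK x} y *\<^sub>R (complex_of_real (ln (absK x) - ln (absK y)) * u y)"
  shows "integrable haar h"
    and "cmod (integral\<^sup>L haar h) \<le> (LINT y:O_K|haar. (ln (absK y))\<^sup>2 + (cmod (u y))\<^sup>2)"
proof -
  let ?g = "\<lambda>y. indicator O_K y *\<^sub>R ((ln (absK y))\<^sup>2 + (cmod (u y))\<^sup>2)"
  have g: "integrable haar ?g"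
    using set_integral_add(1)[OF integrable_ln_absK, of "\<lambda>y. (cmod (u y))\<^sup>2"] u
    by (simp add: square_integrable_on_O_def set_integrable_def)
  have [measurable]: "(\<lambda>y. indicator O_K y *\<^sub>R u y) \<in> borel_measurable haar"
    using u by (simp add: square_integrable_on_O_def set_borel_measurable_def)
  have "h = (\<lambda>y. indicator {y. absK y < absK x} y *\<^sub>R
      (complex_of_real (ln (absK x) - ln (absK y)) * (indicator O_K y *\<^sub>R u y)))"
    using x by (auto simp: h_def O_K_def indicator_def)
  then have meas: "h \<in> borel_measurable haar"
    by (rule ssubst) measurable
  have bound: "AE y in haar. norm (h y) \<le> ?g y"
    using AE_haar_nonzero
  proof eventually_elim
    fix y :: 'a assume "y \<noteq> 0"
    show "norm (h y) \<le> ?g y"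
    proof (cases "absK y < absK x")
      case True
      have y: "0 < absK y" "y \<in> O_K"
        using \<open>y \<noteq> 0\<close> True x absK_nonneg[of y] absK_eq_0_iff[of y] by (auto simp: O_K_def less_le)
      then have "ln (absK y) \<le> ln (absK x)" "ln (absK x) \<le> 0"
        using True x by (auto simp: O_K_def)
      then have "\<bar>ln (absK x) - ln (absK y)\<bar> \<le> \<bar>ln (absK y)\<bar>"
        by linarith
      then have "norm (h y) \<le> \<bar>ln (absK y)\<bar> * cmod (u y)"
        using True unfolding h_def by (simp add: norm_mult mult_right_mono flip: of_real_diff)
      also have "\<dots> \<le> (ln (absK y))\<^sup>2 + (cmod (u y))\<^sup>2"
        using mult_le_sum_squares[of "\<bar>ln (absK y)\<bar>" "cmod (u y)"] by simp
      finally show ?thesis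
        using y by simp
    qed (simp add: h_def)
  qed
  show int: "integrable haar h"
    using g meas by (rule Bochner_Integration.integrable_bound) (use bound in \<open>eventually_elim, simp\<close>)
  have "cmod (integral\<^sup>L haar h) \<le> (LINT y|haar. norm (h y))"
    by (rule integral_norm_bound)
  also have "\<dots> \<le> integral\<^sup>L haar ?g"
    using bound int g by (intro integral_mono_AE) auto
  finally show "cmod (integral\<^sup>L haar h) \<le> (LINT y:O_K|haar. (ln (absK y))\<^sup>2 + (cmod (u y))\<^sup>2)"
    by (simp add: set_lebesgue_integral_def)
qed

lemma radial_L2_fun_I01:
  fixes u :: "'a::local_field \<Rightarrow> complex"
  assumes u: "radial_L2_fun u"
  shows "radial_L2_fun (I01_fun u)"
proof -
  have rad: "radial_on_O (I01_fun u)"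
    unfolding radial_on_O_def I01_fun_def by simp
  define C where "C = cmod (complex_of_real ((1 - real (residue_card TYPE('a))) /
        (real (residue_card TYPE('a)) * ln (real (residue_card TYPE('a)))))) *
      (LINT y:O_K|haar. (ln (absK y))\<^sup>2 + (cmod (u y))\<^sup>2)"
  have "cmod (I01_fun u x) \<le> C" if "x \<in> O_K" for x
    using I01_integral_bound(2)[OF _ that, of u] u
    unfolding I01_fun_def C_def norm_mult radial_L2_fun_def set_lebesgue_integral_def
    by (intro mult_left_mono) auto
  then have "square_integrable_on_O (I01_fun u)"
    using radial_measurable[OF rad] haar_fin_O[where 'a='a]
    by (intro square_integrable_on_OI[where g = "\<lambda>_. C\<^sup>2"])
      (auto intro!: power_mono simp: set_integrable_def)
  then show ?thesis
    using rad by (simp add: radial_L2_fun_def)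
qed

lift_definition I01 :: "'a::local_field radial_L2 \<Rightarrow> 'a radial_L2" is I01_fun
proof -
  fix u v :: "'a \<Rightarrow> complex" assume uv: "radial_L2_rel u v"
  have "I01_fun u x = I01_fun v x" if x: "x \<in> O_K" for x
  proof -
    have "{y. absK y < absK x} \<subseteq> O_K"
      using x by (auto simp: O_K_def)
    moreover have "AE y in haar. y \<in> O_K \<longrightarrow> u y = v y"
      using uv by (simp add: radial_L2_rel_def)
    ultimately have "AE y in haar. indicator {y. absK y < absK x} y *\<^sub>R (complex_of_real (ln (absK x) - ln (absK y)) * u y)
        = indicator {y. absK y < absK x} y *\<^sub>R (complex_of_real (ln (absK x) - ln (absK y)) * v y)"
      by (auto elim!: eventually_mono simp: indicator_def)
    then have "(LINT y:{y. absK y < absK x}|haar. complex_of_real (ln (absK x) - ln (absK y)) * u y)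
        = (LINT y:{y. absK y < absK x}|haar. complex_of_real (ln (absK x) - ln (absK y)) * v y)"
      unfolding set_lebesgue_integral_def
      using I01_integral_bound(1)[OF _ x] uv
      by (intro integral_cong_AE borel_measurable_integrable) (auto simp: radial_L2_rel_def radial_L2_fun_def)
    then show ?thesis
      by (simp add: I01_fun_def)
  qed
  then show "radial_L2_rel (I01_fun u) (I01_fun v)"
    using uv by (simp add: radial_L2_rel_def radial_L2_fun_I01)
qed

end

theory Submission
  imports Defs
begin

text \<open>
  The kernel of \<open>I01\<close> is \<open>c (ln |x| - ln |y|)\<close>, restricted to \<open>|y| < |x|\<close>. Iterates of the operator
  therefore vanish at the origin to higher and higher order, with constants decaying
  superexponentially; so \<open>I01\<close> is quasinilpotent, and as it maps the unit ball into uniformly bounded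
  functions it is compact. Subtracting the adjoint removes the restriction \<open>|y| < |x|\<close> from the kernel,
  so the imaginary part acts on the span of \<open>1\<close> and \<open>ln |x|\<close>, antisymmetrically, whence rank 2 and
  trace 0. On an invariant subspace where \<open>I01\<close> agrees with its adjoint it is symmetric and
  quasinilpotent, hence zero; but a function killed by \<open>I01\<close> and orthogonal to \<open>1\<close> and \<open>ln |x|\<close> is
  zero, as second differences in the radius show.
\<close>

section \<open>Complex inner product spaces\<close>

text \<open>Completeness of the space is never established, so a Neumann series has no limit for
  free and an adjoint has to be exhibited. Compactness of the operator and density of the span of
  sphere indicators take over that role. A second obstacle is that vectors are classes of functions
  while vanishing at the origin is pointwise: the value of \<open>I01 f\<close> at \<open>x\<close>
  is therefore written as an inner product with a section of the kernel, which depends only on the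
  class of \<open>f\<close>. The superexponential constants come from discreteness of the absolute
  value. Its nonzero values are powers of q >= 2, so each integration over |y| < |x| looks only at
  |y| <= |x| / 2, and the factors sqrt (1/2) ^ j multiply to a power of 2 with exponent quadratic in
  the number of iterations. If the sphere of radius q^(-n) is indexed by n, the kernel between
  spheres m and n is a constant times the truncated difference n - m. The formula for the adjoint is
  then the decomposition of an integer into positive and negative part.\<close>

lemma cinner_add_right: "cinner x (y + z) = cinner x y + cinner x z"
  by (metis cinner_commute cinner_add_left complex_cnj_add)

lemma cinner_scaleC_right: "cinner x (scaleC a y) = cnj a * cinner x y"
  by (metis cinner_commute cinner_scaleC_left complex_cnj_mult)

lemma cinner_self: "cinner x x = complex_of_real ((norm x)\<^sup>2)"
proof (rule complex_eqI)
  show "Re (cinner x x) = Re (complex_of_real ((norm x)\<^sup>2))"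
    by (simp add: inner_eq_Re_cinner[symmetric] dot_square_norm)
  have "cinner x x = cnj (cinner x x)"
    by (rule cinner_commute)
  then show "Im (cinner x x) = Im (complex_of_real ((norm x)\<^sup>2))"
    by (metis Im_complex_of_real complex_cnj cnj.simps(2) neg_equal_zero)
qed

lemma norm_scaleC: "norm (scaleC a x) = cmod a * norm x"
proof -
  have "complex_of_real ((norm (scaleC a x))\<^sup>2) = a * cnj a * complex_of_real ((norm x)\<^sup>2)"
    by (simp only: cinner_self[symmetric] cinner_scaleC_left cinner_scaleC_right mult_ac)
  also have "\<dots> = complex_of_real ((cmod a * norm x)\<^sup>2)"
    by (simp only: complex_norm_square[symmetric] power_mult_distrib of_real_mult)
  finally have "(norm (scaleC a x))\<^sup>2 = (cmod a * norm x)\<^sup>2"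
    by (simp only: of_real_eq_iff)
  then show ?thesis
    by (rule power2_eq_imp_eq) simp_all
qed

text \<open>Multiplying \<open>x\<close> by a suitable phase makes the inner product real and
  nonnegative, so the inequality for the real inner product already bounds the full modulus.\<close>

lemma Cauchy_Schwarz_cinner: "cmod (cinner x y) \<le> norm x * norm y"
proof (cases "cinner x y = 0")
  case False
  define a where "a = cnj (cinner x y) / cmod (cinner x y)"
  have "a * cinner x y = cmod (cinner x y)"
    using False complex_norm_square[of "cinner x y"]
    by (simp add: a_def field_simps power2_eq_square)
  then have "cmod (cinner x y) = inner (scaleC a x) y"
    by (simp add: inner_eq_Re_cinner cinner_scaleC_left)
  also have "\<dots> \<le> norm (scaleC a x) * norm y"
    by (rule norm_cauchy_schwarz)
  also have "cmod a = 1"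
    using False by (simp add: a_def norm_divide)
  then have "norm (scaleC a x) = norm x"
    by (simp add: norm_scaleC)
  finally show ?thesis .
qed simp

section \<open>Continuity of the inner product and of complex scaling\<close>

lemma bounded_linear_cinner_left: "bounded_linear (\<lambda>x. cinner x y)"
  by (rule bounded_linear_intro[where K = "norm y"])
    (auto simp: cinner_add_left scaleR_scaleC cinner_scaleC_left scaleR_conv_of_real Cauchy_Schwarz_cinner)

lemma bounded_linear_cinner_right: "bounded_linear (\<lambda>y. cinner x y)"
  by (rule bounded_linear_intro[where K = "norm x"])
    (use Cauchy_Schwarz_cinner[of x] in
      \<open>auto simp: cinner_add_right scaleR_scaleC cinner_scaleC_right scaleR_conv_of_real mult.commute\<close>)

lemma bounded_linear_scaleC: "bounded_linear (\<lambda>x. scaleC a x)"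
  by (rule bounded_linear_intro[where K = "cmod a"])
    (auto simp: scaleC_add_right scaleR_scaleC scaleC_scaleC norm_scaleC mult.commute)

lemma bounded_linear_scaleC_left: "bounded_linear (\<lambda>a. scaleC a x)"
  by (rule bounded_linear_intro[where K = "norm x"])
    (auto simp: scaleC_add_left scaleR_scaleC scaleC_scaleC norm_scaleC scaleR_conv_of_real)

lemmas cinner_diff_left = linear_diff[OF bounded_linear.linear[OF bounded_linear_cinner_left]]
lemmas cinner_diff_right = linear_diff[OF bounded_linear.linear[OF bounded_linear_cinner_right]]
lemmas cinner_sum_left = linear_sum[OF bounded_linear.linear[OF bounded_linear_cinner_left]]
lemmas cinner_zero_left = linear_0[OF bounded_linear.linear[OF bounded_linear_cinner_left]]
lemmas cinner_zero_right = linear_0[OF bounded_linear.linear[OF bounded_linear_cinner_right]]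
lemmas scaleC_diff_right = linear_diff[OF bounded_linear.linear[OF bounded_linear_scaleC]]
lemmas scaleC_sum_right = linear_sum[OF bounded_linear.linear[OF bounded_linear_scaleC]]

lemma scaleC_one [simp]: "scaleC 1 x = x"
  by (rule complex_vector.scale_one)

text \<open>Existence in the definite description is supplied by \<open>B\<close> itself, so no
  representation theorem is involved; uniqueness follows by testing the difference of two candidates
  against itself.\<close>

lemma cadjoint_eqI:
  assumes "\<And>x y. cinner (A x) y = cinner x (B y)"
  shows "cadjoint A = B"
  unfolding cadjoint_def
proof (rule the_equality)
  show "\<forall>x y. cinner (A x) y = cinner x (B y)"
    by (intro allI assms)
  fix B' assume B': "\<forall>x y. cinner (A x) y = cinner x (B' y)"
  show "B' = B"
  proof
    fix y
    have "cinner (B' y - B y) (B' y - B y) = 0"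
      using B' assms by (simp add: cinner_diff_right)
    then show "B' y = B y"
      by (simp add: cinner_self)
  qed
qed

text \<open>Parseval's identity, for a basis of any cardinality. By density some finite combination
  is close to \<open>f\<close>. For every finite \<open>F\<close> containing its support, the
  projection \<open>P F\<close> is at least as close, being the best approximation from the span of
  \<open>F\<close>; hence \<open>P\<close> converges along finite subsets, and continuity of the
  inner product does the rest.\<close>

lemma orthonormal_basis_has_sum:
  assumes "orthonormal_basis E"
  shows "((\<lambda>e. cinner f e * cinner e g) has_sum cinner f g) E"
proof -
  have orth: "cinner e e' = (if e = e' then 1 else 0)" if "e \<in> E" "e' \<in> E" for e e'
    using assms that unfolding orthonormal_basis_def by blast
  define P where "P F = (\<Sum>e\<in>F. scaleC (cinner f e) e)" for F
  have best: "norm (f - P F) \<le> norm (f - y)" if F: "finite F" "F \<subseteq> E" "y \<in> cspan F" for F y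
  proof -
    have perp: "cinner (f - P F) e = 0" if "e \<in> F" for e
    proof -
      have "cinner (P F) e = (\<Sum>e'\<in>F. if e' = e then cinner f e else 0)"
        unfolding P_def cinner_sum_left cinner_scaleC_left
        using F that by (intro sum.cong) (auto simp: orth subset_iff)
      then show ?thesis
        using F that by (simp add: cinner_diff_left)
    qed
    have "cinner (f - P F) z = 0" if "z \<in> cspan F" for z
      using that
      by (induction rule: complex_vector.span_induct_alt)
        (auto simp: cinner_zero_right cinner_add_right cinner_scaleC_right perp)
    moreover have "P F - y \<in> cspan F"
      unfolding P_def
      by (intro complex_vector.span_diff complex_vector.span_sum complex_vector.span_scale
          complex_vector.span_base that(3))
    ultimately have "inner (f - P F) (P F - y) = 0"
      by (simp add: inner_eq_Re_cinner)
    then have "(norm (f - P F + (P F - y)))\<^sup>2 = (norm (f - P F))\<^sup>2 + (norm (P F - y))\<^sup>2"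
      by (intro norm_add_Pythagorean) (simp add: orthogonal_def)
    then have "(norm (f - P F))\<^sup>2 \<le> (norm (f - y))\<^sup>2"
      by simp
    then show ?thesis
      by (rule power2_le_imp_le) simp
  qed
  have "(P \<longlongrightarrow> f) (finite_subsets_at_top E)"
    unfolding tendsto_iff
  proof (intro allI impI)
    fix d :: real assume "d > 0"
    then obtain y where y: "y \<in> cspan E" "dist y f < d"
      using assms by (metis UNIV_I closure_approachable orthonormal_basis_def)
    then obtain F0 r where F0: "finite F0" "F0 \<subseteq> E" "y = (\<Sum>a\<in>F0. scaleC (r a) a)"
      unfolding complex_vector.span_explicit by auto
    show "\<forall>\<^sub>F F in finite_subsets_at_top E. dist (P F) f < d"
      unfolding eventually_finite_subsets_at_top
    proof (intro exI[of _ F0] conjI allI impI)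
      fix F assume F: "finite F \<and> F0 \<subseteq> F \<and> F \<subseteq> E"
      then have "y \<in> cspan F"
        unfolding F0(3) by (intro complex_vector.span_sum complex_vector.span_scale
            complex_vector.span_base) auto
      then have "norm (f - P F) \<le> norm (f - y)"
        using F by (intro best) auto
      then show "dist (P F) f < d"
        using y(2) by (simp add: dist_norm norm_minus_commute)
    qed (use F0 in auto)
  qed
  then have "((\<lambda>F. cinner (P F) g) \<longlongrightarrow> cinner f g) (finite_subsets_at_top E)"
    by (rule bounded_linear.tendsto[OF bounded_linear_cinner_left])
  then show ?thesis
    unfolding has_sum_def P_def cinner_sum_left cinner_scaleC_left .
qed


section \<open>Quasinilpotent operators\<close>

lemma bounded_clinear_power:
  assumes "bounded_clinear A"
  shows "bounded_clinear (A ^^ k)"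
proof (induction k)
  case 0
  then show ?case
    using bounded_linear_ident by (simp add: bounded_clinear_def id_def)
next
  case (Suc k)
  then show ?case
    using assms bounded_linear_compose[of A "A ^^ k"] by (auto simp: bounded_clinear_def o_def)
qed

text \<open>For \<open>l\<close> nonzero, the resolvent is the Neumann series in \<open>A\<close>
  divided by \<open>l\<close>; the constants \<open>C k\<close> beat every geometric progression, so
  it converges absolutely whatever \<open>l\<close> is.\<close>

lemma op_spectrum_quasinilpotent:
  assumes A: "compact_operator A"
    and C: "\<And>k x. norm ((A ^^ k) x) \<le> C k * norm x"
    and C_summable: "\<And>r :: real. summable (\<lambda>k. r ^ k * C k)"
  shows "op_spectrum A \<subseteq> {0}"
proof
  fix l assume l: "l \<in> op_spectrum A"
  show "l \<in> {0}"
  proof (rule ccontr)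
    assume "l \<notin> {0}"
    define m where "m = 1 / l"
    have m: "m * l = 1" "l * m = 1"
      using \<open>l \<notin> {0}\<close> by (simp_all add: m_def)
    have blA: "bounded_linear A" and scA: "A (scaleC c x) = scaleC c (A x)" for c x
      using A by (auto simp: compact_operator_def bounded_clinear_def)
    have powA: "bounded_linear (A ^^ k)" "(A ^^ k) (scaleC c x) = scaleC c ((A ^^ k) x)" for k c x
      using A bounded_clinear_power[of A k] by (auto simp: compact_operator_def bounded_clinear_def)
    define S where "S x N = (\<Sum>k<N. scaleC (m ^ k) ((A ^^ k) x))" for x N
    define R where "R = (\<Sum>k. cmod m ^ k * C k)"
    have term_le: "norm (scaleC (m ^ k) ((A ^^ k) x)) \<le> cmod m ^ k * C k * norm x" for k x
      using C[of k x] by (simp add: norm_scaleC norm_power mult_left_mono mult.assoc)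
    have summ: "summable (\<lambda>k. cmod m ^ k * C k * norm x)" for x
      by (intro summable_mult2 C_summable)
    have summ_norm: "summable (\<lambda>k. norm (scaleC (m ^ k) ((A ^^ k) x)))" for x
      using term_le by (intro summable_comparison_test'[OF summ]) auto
    have S_le: "norm (S x N) \<le> R * norm x" for x N
    proof -
      have "norm (S x N) \<le> (\<Sum>k<N. cmod m ^ k * C k * norm x)"
        unfolding S_def by (intro sum_norm_le term_le)
      also have "\<dots> \<le> (\<Sum>k. cmod m ^ k * C k * norm x)"
        using term_le norm_ge_zero order_trans by (intro sum_le_suminf summ) blast+
      also have "\<dots> = R * norm x"
        unfolding R_def by (rule suminf_mult2[OF C_summable, symmetric])
      finally show ?thesis .
    qed
    \<comment> \<open>This recursion identifies the limit and also reduces convergence of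
      \<open>S x\<close> to convergence of its image under \<open>A\<close>.\<close>
    have S_Suc: "S x (Suc N) = x + scaleC m (A (S x N))" for x N
      unfolding S_def sum.lessThan_Suc_shift
      by (simp add: linear_sum[OF bounded_linear.linear[OF blA]] scA scaleC_sum_right scaleC_scaleC)
    have Cauchy_S: "Cauchy (S x)" for x
    proof (rule CauchyI')
      fix e :: real assume "e > 0"
      let ?T = "\<lambda>N. \<Sum>k<N. norm (scaleC (m ^ k) ((A ^^ k) x))"
      have "Cauchy ?T"
        using summ_norm[of x] unfolding summable_iff_convergent by (rule convergent_Cauchy)
      then obtain M where M: "\<And>i j. i \<ge> M \<Longrightarrow> j \<ge> M \<Longrightarrow> norm (?T i - ?T j) < e"
        using CauchyD[OF _ \<open>e > 0\<close>, of ?T] by blast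
      have "norm (S x i - S x j) < e" if "M \<le> i" "i < j" for i j
      proof -
        have "norm (S x i - S x j) = norm (\<Sum>k\<in>{i..<j}. scaleC (m ^ k) ((A ^^ k) x))"
          using that sum_diff_nat_ivl[of 0 i j "\<lambda>k. scaleC (m ^ k) ((A ^^ k) x)"]
          by (subst norm_minus_commute) (simp add: S_def lessThan_atLeast0)
        also have "\<dots> \<le> (\<Sum>k\<in>{i..<j}. norm (scaleC (m ^ k) ((A ^^ k) x)))"
          by (rule norm_sum)
        also have "\<dots> = ?T j - ?T i"
          using that sum_diff_nat_ivl[of 0 i j "\<lambda>k. norm (scaleC (m ^ k) ((A ^^ k) x))"]
          by (simp add: lessThan_atLeast0)
        finally show ?thesis
          using M[of j i] that by simp
      qed
      then show "\<exists>M. \<forall>i\<ge>M. \<forall>j>i. dist (S x i) (S x j) < e"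
        unfolding dist_norm by blast
    qed
    \<comment> \<open>The space need not be complete: the limit comes from the compact image of a ball.\<close>
    have "convergent (S x)" for x
    proof -
      \<comment> \<open>Dividing by \<open>r\<close> brings every partial sum into the unit ball.
        The bound at index 0 gives 0 \<le> \<open>R * norm x\<close>, and the added 1 makes
        \<open>r\<close> positive.\<close>
      define r where "r = R * norm x + 1"
      have "r > 0"
        using S_le[of x 0] by (simp add: r_def S_def)
      define y where "y N = A ((1 / r) *\<^sub>R S x N)" for N
      have "Cauchy y"
        unfolding y_def
        by (intro bounded_linear.Cauchy[OF bounded_linear_compose[OF blA bounded_linear_scaleR_right]]
            Cauchy_S)
      moreover have "y N \<in> closure (A ` cball 0 1)" for N
      proof -
        have "(1 / r) *\<^sub>R S x N \<in> cball 0 1"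
          using S_le[of x N] \<open>r > 0\<close> by (simp add: r_def)
        then show ?thesis
          unfolding y_def by (intro subsetD[OF closure_subset] imageI)
      qed
      moreover have "complete (closure (A ` cball 0 1))"
        using A by (simp add: compact_operator_def compact_imp_complete)
      ultimately obtain z where z: "y \<longlonglongrightarrow> z"
        unfolding complete_def by blast
      have "S x (Suc N) = x + scaleC m (r *\<^sub>R y N)" for N
        using \<open>r > 0\<close> by (simp add: S_Suc y_def linear_scale[OF bounded_linear.linear[OF blA]])
      moreover have "(\<lambda>N. x + scaleC m (r *\<^sub>R y N)) \<longlonglongrightarrow> x + scaleC m (r *\<^sub>R z)"
        by (intro tendsto_intros bounded_linear.tendsto[OF bounded_linear_scaleC] z)
      ultimately have "(\<lambda>N. S x (Suc N)) \<longlonglongrightarrow> x + scaleC m (r *\<^sub>R z)"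
        by simp
      then show ?thesis
        using LIMSEQ_imp_Suc convergent_def by blast
    qed
    then obtain L where L: "\<And>x. S x \<longlonglongrightarrow> L x"
      unfolding convergent_def by metis
    have AS: "A (S x N) = S (A x) N" for x N
      by (simp add: S_def linear_sum[OF bounded_linear.linear[OF blA]] scA funpow_swap1)
    have AL: "L (A x) = A (L x)" for x
      using L[of "A x"] bounded_linear.tendsto[OF blA L[of x]] unfolding AS by (rule LIMSEQ_unique)
    have L_eq: "L x = x + scaleC m (A (L x))" for x
    proof (rule LIMSEQ_unique)
      show "(\<lambda>N. S x (Suc N)) \<longlonglongrightarrow> L x"
        by (rule LIMSEQ_Suc[OF L])
      show "(\<lambda>N. S x (Suc N)) \<longlonglongrightarrow> x + scaleC m (A (L x))"
        unfolding S_Suc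
        by (intro tendsto_intros bounded_linear.tendsto[OF bounded_linear_scaleC]
            bounded_linear.tendsto[OF blA] L)
    qed
    have L_add: "L (x + y) = L x + L y" for x y
    proof (rule LIMSEQ_unique[OF L])
      have "S (x + y) = (\<lambda>N. S x N + S y N)"
        by (simp add: fun_eq_iff S_def linear_add[OF bounded_linear.linear[OF powA(1)]] scaleC_add_right sum.distrib)
      then show "S (x + y) \<longlonglongrightarrow> L x + L y"
        by (simp add: tendsto_add L)
    qed
    have L_scale: "L (scaleC c x) = scaleC c (L x)" for c x
    proof (rule LIMSEQ_unique[OF L])
      have "S (scaleC c x) = (\<lambda>N. scaleC c (S x N))"
        by (simp add: fun_eq_iff S_def powA(2) scaleC_sum_right scaleC_scaleC mult.commute)
      then show "S (scaleC c x) \<longlonglongrightarrow> scaleC c (L x)"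
        by (simp add: bounded_linear.tendsto[OF bounded_linear_scaleC] L)
    qed
    have L_le: "norm (L x) \<le> norm x * R" for x
      using S_le[of x] by (intro Lim_bounded[OF tendsto_norm[OF L[of x]]]) (simp add: mult.commute)
    \<comment> \<open>\<open>L\<close> inverts 1 - m A, and A - l = -l (1 - m A), so the inverse of
      A - l has to be -m L.\<close>
    define B where "B x = scaleC (- m) (L x)" for x
    have "bounded_linear L"
      using L_le by (intro bounded_linear_intro) (auto simp: L_add L_scale scaleR_scaleC)
    then have "bounded_linear B"
      unfolding B_def using bounded_linear_compose[OF bounded_linear_scaleC] by blast
    then have B: "bounded_clinear B"
      by (simp add: bounded_clinear_def B_def L_scale scaleC_scaleC mult.commute)
    have inv: "scaleC (- m) (A (L x) - scaleC l (L x)) = x" for x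
    proof -
      have "scaleC (- m) (A (L x) - scaleC l (L x)) = L x - scaleC m (A (L x))"
        using m by (simp add: scaleC_diff_right scaleC_scaleC)
      then show ?thesis
        using L_eq[of x] by (metis add_diff_cancel_right')
    qed
    have "A (B x) - scaleC l (B x) = x" for x
      using inv[of x] by (simp only: B_def scA scaleC_diff_right scaleC_scaleC mult.commute)
    moreover have "B (A x - scaleC l x) = x" for x
      using inv[of x] linear_diff[OF bounded_linear.linear[OF \<open>bounded_linear L\<close>], of "A x" "scaleC l x"]
      by (simp add: B_def AL L_scale)
    ultimately show False
      using l B unfolding op_spectrum_def by blast
  qed
qed

text \<open>Symmetry is available only on \<open>M\<close>, so the argument follows the orbit of a
  single vector, which stays in \<open>M\<close>, instead of operator norms or spectral
  theory.\<close>

lemma symmetric_quasinilpotent_eq_0: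
  fixes A :: "'h::complex_inner \<Rightarrow> 'h"
  assumes C: "\<And>k x. norm ((A ^^ k) x) \<le> C k * norm x"
    and C_summable: "\<And>r :: real. summable (\<lambda>k. r ^ k * C k)"
    and M: "A ` M \<subseteq> M"
    and sym: "\<And>x y. x \<in> M \<Longrightarrow> y \<in> M \<Longrightarrow> cinner (A x) y = cinner x (A y)"
    and x: "x \<in> M"
  shows "A x = 0"
proof (rule ccontr)
  assume nz: "A x \<noteq> 0"
  define a where "a k = norm ((A ^^ k) x)" for k
  have inM: "(A ^^ k) x \<in> M" for k
    using M x by (induction k) auto
  \<comment> \<open>Symmetry makes the norms of the iterates log-convex, so they decay at most geometrically.\<close>
  have convex: "(a (Suc k))\<^sup>2 \<le> a (Suc (Suc k)) * a k" for k
  proof -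
    have "(a (Suc k))\<^sup>2 = cmod (cinner (A ((A ^^ k) x)) ((A ^^ Suc k) x))"
      using cinner_self[of "(A ^^ Suc k) x"] by (simp add: a_def norm_power)
    also have "cinner (A ((A ^^ k) x)) ((A ^^ Suc k) x) = cinner ((A ^^ k) x) ((A ^^ Suc (Suc k)) x)"
      using sym[OF inM[of k] inM[of "Suc k"]] by simp
    also have "cmod \<dots> \<le> a k * a (Suc (Suc k))"
      unfolding a_def by (rule Cauchy_Schwarz_cinner)
    finally show ?thesis
      by (simp add: mult.commute)
  qed
  have a1: "a 1 > 0"
    using nz by (simp add: a_def)
  have "a 1 \<le> C 1 * a 0"
    using C[of 1 x] by (simp add: a_def)
  then have a0: "a 0 > 0"
    using a1 by (metis a_def mult_zero_right norm_ge_zero not_less order_le_less)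
  define r where "r = a 1 / a 0"
  have r: "r > 0"
    using a0 a1 by (simp add: r_def)
  have step: "a k > 0 \<and> r * a k \<le> a (Suc k)" for k
  proof (induction k)
    case 0
    then show ?case
      using a0 by (simp add: r_def)
  next
    case (Suc k)
    then have pos: "a (Suc k) > 0"
      using r by (meson mult_pos_pos order_less_le_trans)
    have "r * a (Suc k) * a k \<le> a (Suc k) * a (Suc k)"
      using Suc pos by (simp add: mult_ac mult_right_mono)
    also have "\<dots> \<le> a (Suc (Suc k)) * a k"
      using convex[of k] by (simp add: power2_eq_square)
    finally show ?case
      using Suc pos by (simp add: mult_le_cancel_right)
  qed
  have lower: "r ^ k * a 0 \<le> a k" for k
  proof (induction k)
    case (Suc k)
    then have "r * (r ^ k * a 0) \<le> r * a k"
      using r by (intro mult_left_mono) auto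
    then show ?case
      using step[of k] by (simp add: mult.assoc)
  qed simp
  \<comment> \<open>Summability is tested at the reciprocal of the growth rate \<open>r\<close>: the
    terms stay above 1 there and cannot tend to zero.\<close>
  have "1 \<le> (1 / r) ^ k * C k" for k
  proof -
    have "r ^ k * a 0 \<le> C k * a 0"
      using lower[of k] C[of k x] by (simp add: a_def)
    then show ?thesis
      using a0 r by (simp add: power_one_over field_simps)
  qed
  moreover have "(\<lambda>k. (1 / r) ^ k * C k) \<longlonglongrightarrow> 0"
    by (intro summable_LIMSEQ_zero C_summable)
  ultimately have "1 \<le> (0 :: real)"
    by (intro LIMSEQ_le_const) auto
  then show False
    by simp
qed


section \<open>Spheres and balls in a local field\<close>

text \<open>The values of \<open>absK\<close> are discrete, so none lies strictly between
  consecutive powers: an open ball is the closed ball of the next smaller radius.\<close>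

lemma absK_less_imp_le:
  fixes y :: "'a::local_field"
  assumes "absK y < (1 / real (residue_card TYPE('a))) ^ n"
  shows "absK y \<le> (1 / real (residue_card TYPE('a))) ^ Suc n"
proof (cases "y = 0")
  case False
  have q: "real (residue_card TYPE('a)) > 1"
    using residue_card_gt_1[where 'a='a] by simp
  then have "(1 / real (residue_card TYPE('a))) ^ n \<le> 1"
    by (intro power_le_one) auto
  then have "absK y \<le> 1"
    using assms by linarith
  then obtain k where k: "absK y = (1 / real (residue_card TYPE('a))) ^ k"
    using False absK_cases by blast
  have "Suc n \<le> k"
  proof (rule ccontr)
    assume "\<not> Suc n \<le> k"
    then have "(1 / real (residue_card TYPE('a))) ^ n \<le> (1 / real (residue_card TYPE('a))) ^ k"
      using q by (intro power_decreasing) auto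
    then show False
      using assms k by simp
  qed
  then show ?thesis
    unfolding k using q by (intro power_decreasing) auto
qed simp

lemma residue_representatives:
  obtains R :: "'a::local_field set" where "finite R" "card R = residue_card TYPE('a)" "R \<subseteq> O_K"
    and "\<And>r s. r \<in> R \<Longrightarrow> s \<in> R \<Longrightarrow> absK (r - s) < 1 \<Longrightarrow> r = s"
    and "\<And>x. absK x \<le> 1 \<Longrightarrow> \<exists>r\<in>R. absK (x - r) < 1"
proof -
  define E where "E = {(x :: 'a, y). x \<in> O_K \<and> y \<in> O_K \<and> x - y \<in> P_K}"
  have E: "equiv O_K E"
  proof (rule equivI)
    show "E \<subseteq> O_K \<times> O_K"
      by (auto simp: E_def)
    show "refl_on O_K E"
      by (auto simp: E_def refl_on_def P_K_def)
    show "sym E"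
      by (auto simp: E_def sym_def P_K_def absK_minus_commute)
    show "trans E"
    proof (rule transI)
      fix x y z :: 'a assume "(x, y) \<in> E" "(y, z) \<in> E"
      then show "(x, z) \<in> E"
        using absK_add_le_max[of "x - y" "y - z"] by (auto simp: E_def P_K_def)
    qed
  qed
  have classes: "O_K // E = residue_classes"
    by (simp add: residue_classes_def E_def)
  define f where "f X = (SOME x. x \<in> X)" for X :: "'a set"
  have f: "f X \<in> X" if "X \<in> O_K // E" for X
    using in_quotient_imp_non_empty[OF E that] by (auto simp: f_def intro: someI)
  have fO: "f X \<in> O_K" if "X \<in> O_K // E" for X
    using f[OF that] in_quotient_imp_subset[OF E that] by blast
  have inj: "X = Y" if "X \<in> O_K // E" "Y \<in> O_K // E" "absK (f X - f Y) < 1" for X Y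
  proof -
    have "(f X, f Y) \<in> E"
      using that fO by (auto simp: E_def P_K_def)
    then show ?thesis
      using quotient_eqI[OF E that(1,2) f[OF that(1)] f[OF that(2)]] by blast
  qed
  show ?thesis
  proof (rule that[of "f ` (O_K // E)"])
    \<comment> \<open>An infinite set has \<open>card\<close> 0, so a cardinality above 1 yields
      finiteness.\<close>
    have "card (residue_classes :: 'a set set) > 1"
      using residue_card_gt_1[where 'a='a] by (simp add: residue_card_def)
    then show "finite (f ` (O_K // E))"
      unfolding classes by (intro finite_imageI) (metis card.infinite not_one_less_zero)
    have "inj_on f (O_K // E)"
      by (intro inj_onI inj) auto
    then show "card (f ` (O_K // E)) = residue_card TYPE('a)"
      by (simp add: card_image classes residue_card_def)
    show "f ` (O_K // E) \<subseteq> O_K"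
      using fO by blast
    show "r = s" if "r \<in> f ` (O_K // E)" "s \<in> f ` (O_K // E)" "absK (r - s) < 1" for r s
      using that inj by blast
    show "\<exists>r\<in>f ` (O_K // E). absK (x - r) < 1" if "absK x \<le> 1" for x :: 'a
    proof -
      have X: "E `` {x} \<in> O_K // E"
        using that by (intro quotientI) (simp add: O_K_def)
      then have "(x, f (E `` {x})) \<in> E"
        using f by blast
      then show ?thesis
        using X by (auto simp: E_def P_K_def)
    qed
  qed
qed

lemma open_translate_ball_K: "open ((+) a ` ball_K n :: 'a::local_field set)"
  unfolding open_iff_absK
proof (intro ballI exI conjI allI impI)
  let ?e = "(1 / real (residue_card TYPE('a))) ^ n"
  show "?e > 0"
    using residue_card_gt_1[where 'a='a] by simp
  fix x y :: 'a assume "x \<in> (+) a ` ball_K n" "absK (y - x) < ?e"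
  then have "absK (y - a) \<le> ?e"
    using absK_add_le_max[of "y - x" "x - a"] by (auto simp: ball_K_def)
  then show "y \<in> (+) a ` ball_K n"
    by (intro image_eqI[of _ _ "y - a"]) (auto simp: ball_K_def)
qed

text \<open>The ball of radius q^(-n) is the disjoint union of the cosets p^n r +
  \<open>ball_K (Suc n)\<close>, where \<open>p\<close> has absolute value 1/q and \<open>r\<close>
  runs through representatives of the residue field. By translation invariance the q cosets have
  equal measure.\<close>

lemma emeasure_ball_K_Suc:
  "emeasure haar (ball_K n :: 'a::local_field set) =
    of_nat (residue_card TYPE('a)) * emeasure haar (ball_K (Suc n) :: 'a set)"
proof -
  let ?q = "real (residue_card TYPE('a))"
  have q: "?q > 1"
    using residue_card_gt_1[where 'a='a] by simp
  obtain R :: "'a set" where R: "finite R" "card R = residue_card TYPE('a)" "R \<subseteq> O_K"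
    and R_inj: "\<And>r s. r \<in> R \<Longrightarrow> s \<in> R \<Longrightarrow> absK (r - s) < 1 \<Longrightarrow> r = s"
    and R_cover: "\<And>x. absK x \<le> 1 \<Longrightarrow> \<exists>r\<in>R. absK (x - r) < 1"
    by (rule residue_representatives[where 'a='a]) blast
  obtain p :: 'a where "absK p = 1 / ?q"
    by (rule absK_uniformizer)
  then have p: "absK (p ^ n) = (1 / ?q) ^ n"
    by (simp only: absK_power)
  have pn: "0 < (1 / ?q) ^ n" and pS: "(1 / ?q) ^ Suc n < (1 / ?q) ^ n"
    using q by (auto intro: power_strict_decreasing simp del: power_Suc)
  then have "p ^ n \<noteq> 0"
    using p by (metis absK_0 less_irrefl)
  define T where "T r = (+) (p ^ n * r) ` ball_K (Suc n)" for r
  have T: "x \<in> T r \<longleftrightarrow> absK (x - p ^ n * r) \<le> (1 / ?q) ^ Suc n" for x r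
  proof
    assume "absK (x - p ^ n * r) \<le> (1 / ?q) ^ Suc n"
    then show "x \<in> T r"
      unfolding T_def by (intro image_eqI[of _ _ "x - p ^ n * r"]) (auto simp: ball_K_def)
  qed (auto simp: T_def ball_K_def)
  have "ball_K n = (\<Union>r\<in>R. T r)"
  proof (intro set_eqI iffI)
    fix x :: 'a assume x: "x \<in> ball_K n"
    have "absK (x / p ^ n) * absK (p ^ n) = absK x"
      using \<open>p ^ n \<noteq> 0\<close> by (simp flip: absK_mult)
    then have "absK (x / p ^ n) * (1 / ?q) ^ n \<le> 1 * (1 / ?q) ^ n"
      using x p by (simp add: ball_K_def)
    then have "absK (x / p ^ n) \<le> 1"
      using pn by (rule mult_right_le_imp_le)
    then obtain r where r: "r \<in> R" "absK (x / p ^ n - r) < 1"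
      using R_cover by blast
    have "x - p ^ n * r = (x / p ^ n - r) * p ^ n"
      using \<open>p ^ n \<noteq> 0\<close> by (simp add: field_simps)
    then have "absK (x - p ^ n * r) = absK (x / p ^ n - r) * (1 / ?q) ^ n"
      by (simp only: absK_mult p)
    also have "\<dots> < 1 * (1 / ?q) ^ n"
      using r pn by (intro mult_strict_right_mono)
    finally have "absK (x - p ^ n * r) < (1 / ?q) ^ n"
      by simp
    then have "absK (x - p ^ n * r) \<le> (1 / ?q) ^ Suc n"
      by (rule absK_less_imp_le)
    then show "x \<in> (\<Union>r\<in>R. T r)"
      using r T by blast
  next
    fix x :: 'a assume "x \<in> (\<Union>r\<in>R. T r)"
    then obtain r where r: "r \<in> R" "absK (x - p ^ n * r) \<le> (1 / ?q) ^ Suc n"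
      using T by blast
    have "absK (p ^ n * r) \<le> (1 / ?q) ^ n"
      using r R(3) pn by (auto simp: absK_mult p O_K_def intro: mult_left_le)
    then show "x \<in> ball_K n"
      using absK_add_le_max[of "x - p ^ n * r" "p ^ n * r"] r pS by (simp add: ball_K_def del: power_Suc)
  qed
  moreover have "disjoint_family_on T R"
    unfolding disjoint_family_on_def
  proof (intro ballI impI equals0I)
    fix r s x assume rs: "r \<in> R" "s \<in> R" "r \<noteq> s" and x: "x \<in> T r \<inter> T s"
    have "absK (p ^ n * (r - s)) = absK ((x - p ^ n * s) + - (x - p ^ n * r))"
      by (simp add: algebra_simps)
    also have "\<dots> \<le> max (absK (x - p ^ n * s)) (absK (- (x - p ^ n * r)))"
      by (rule absK_add_le_max)
    also have "\<dots> < (1 / ?q) ^ n"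
      using x T pS unfolding absK_minus by (auto simp del: power_Suc)
    finally have "(1 / ?q) ^ n * absK (r - s) < (1 / ?q) ^ n * 1"
      by (simp add: absK_mult p)
    then have "absK (r - s) < 1"
      using pn by (subst (asm) mult_less_cancel_left_pos)
    then show False
      using R_inj rs by blast
  qed
  moreover have "T r \<in> sets haar" for r
    unfolding T_def sets_haar by (rule borel_open[OF open_translate_ball_K])
  ultimately have "emeasure haar (ball_K n :: 'a set) = (\<Sum>r\<in>R. emeasure haar (T r))"
    using sum_emeasure[of T R haar] R(1) by (simp add: image_subset_iff)
  then show ?thesis
    using R(2) by (simp add: T_def emeasure_haar_translate)
qed

lemma emeasure_ball_K_eq:
  "emeasure haar (ball_K n :: 'a::local_field set) = ennreal ((1 / real (residue_card TYPE('a))) ^ n)"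
proof (induction n)
  case 0
  then show ?case
    using emeasure_haar_O[where 'a='a] by (simp add: ball_K_def O_K_def)
next
  case (Suc n)
  let ?q = "real (residue_card TYPE('a))"
  have q: "?q > 0"
    using residue_card_gt_1[where 'a='a] by simp
  have "emeasure haar (ball_K (Suc n) :: 'a set) \<noteq> \<infinity>"
    using emeasure_ball_K[where 'a='a and n = "Suc n"] by (auto simp: top_unique)
  then obtain r where r: "r \<ge> 0" "emeasure haar (ball_K (Suc n) :: 'a set) = ennreal r"
    by (cases "emeasure haar (ball_K (Suc n) :: 'a set)") auto
  have "ennreal ((1 / ?q) ^ n) = ennreal (?q * r)"
    using Suc emeasure_ball_K_Suc[where 'a='a and n = n] r
    by (simp add: ennreal_mult ennreal_of_nat_eq_real_of_nat)
  then have "(1 / ?q) ^ n = ?q * r"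
    using r q by (subst (asm) ennreal_inj) auto
  then have "r = (1 / ?q) ^ Suc n"
    using q by simp
  then show ?case
    using r by simp
qed

lemma measure_ball_K:
  "measure haar (ball_K n :: 'a::local_field set) = (1 / real (residue_card TYPE('a))) ^ n"
  by (simp add: measure_def emeasure_ball_K_eq)

text \<open>Together with the null set {0} the spheres partition \<open>O_K\<close>, so a radial
  function is, up to that null set, a sequence indexed by \<open>n\<close>.\<close>

definition sphere_K :: "nat \<Rightarrow> 'a::local_field set" where
  "sphere_K n = {x. absK x = (1 / real (residue_card TYPE('a))) ^ n}"

lemma sphere_K_borel [measurable, simp]: "sphere_K n \<in> sets (borel :: 'a::local_field measure)"
  unfolding sphere_K_def by measurable

lemma sphere_K_subset: "sphere_K n \<subseteq> O_K"
proof
  fix x :: 'a assume "x \<in> sphere_K n"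
  moreover have "(1 / real (residue_card TYPE('a))) ^ n \<le> 1"
    using residue_card_gt_1[where 'a='a] by (intro power_le_one) auto
  ultimately show "x \<in> O_K"
    by (simp add: sphere_K_def O_K_def)
qed

lemma ball_K_subset: "ball_K n \<subseteq> O_K"
proof
  fix x :: 'a assume "x \<in> ball_K n"
  moreover have "(1 / real (residue_card TYPE('a))) ^ n \<le> 1"
    using residue_card_gt_1[where 'a='a] by (intro power_le_one) auto
  ultimately show "x \<in> O_K"
    by (simp add: ball_K_def O_K_def)
qed

text \<open>A sphere is the difference of two consecutive balls. Its positive mass makes it nonempty
  and makes the value of a radial function on it an invariant of the class.\<close>

lemma measure_sphere_K_pos: "measure haar (sphere_K n :: 'a::local_field set) > 0"
proof -
  let ?q = "real (residue_card TYPE('a))"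
  have q: "?q > 1"
    using residue_card_gt_1[where 'a='a] by simp
  have lt: "(1 / ?q) ^ Suc n < (1 / ?q) ^ n"
    using q by (intro power_strict_decreasing) auto
  have "(sphere_K n :: 'a set) = ball_K n - ball_K (Suc n)"
  proof (intro set_eqI iffI)
    fix x :: 'a assume "x \<in> ball_K n - ball_K (Suc n)"
    then show "x \<in> sphere_K n"
      using absK_less_imp_le[of x n]
      by (cases "absK x < (1 / ?q) ^ n") (auto simp: sphere_K_def ball_K_def)
  qed (use lt in \<open>auto simp: sphere_K_def ball_K_def simp del: power_Suc\<close>)
  moreover have "ball_K (Suc n) \<subseteq> (ball_K n :: 'a set)"
    using lt by (auto simp: ball_K_def simp del: power_Suc)
  ultimately have "measure haar (sphere_K n :: 'a set) = (1 / ?q) ^ n - (1 / ?q) ^ Suc n"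
    using measure_Diff[of haar "ball_K n :: 'a set" "ball_K (Suc n)"]
    by (simp add: measure_ball_K emeasure_ball_K_eq del: power_Suc)
  then show ?thesis
    using lt by simp
qed

lemma sphere_K_cases:
  assumes "x \<in> O_K" "x \<noteq> 0"
  obtains n where "x \<in> sphere_K n"
  using absK_cases[of x] assms by (auto simp: O_K_def sphere_K_def)

lemma ln_absK_sphere:
  assumes "(x :: 'a::local_field) \<in> sphere_K n"
  shows "ln (absK x) = - real n * ln (real (residue_card TYPE('a)))"
  using assms residue_card_gt_1[where 'a='a] by (simp add: sphere_K_def ln_realpow ln_div)

lemma sphere_K_less_iff:
  assumes "(x :: 'a::local_field) \<in> sphere_K m" "(y :: 'a) \<in> sphere_K n"
  shows "absK y < absK x \<longleftrightarrow> m < n"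
proof -
  have "real (residue_card TYPE('a)) > 1"
    using residue_card_gt_1[where 'a='a] by simp
  then show ?thesis
    using assms by (simp add: sphere_K_def power_strict_decreasing_iff)
qed

lemma sphere_K_nonempty: obtains x :: "'a::local_field" where "x \<in> sphere_K n"
  using measure_sphere_K_pos[where 'a='a and n = n] by (metis ex_in_conv less_irrefl measure_empty)

lemma sphere_K_disjoint:
  assumes "(x :: 'a::local_field) \<in> sphere_K m" "x \<in> sphere_K n"
  shows "m = n"
  using sphere_K_less_iff[OF assms] sphere_K_less_iff[OF assms(2,1)] by simp


section \<open>Radial functions and their classes\<close>

lemma radial_L2_cases:
  obtains u where "radial_L2_fun u" "f = abs_radial_L2 u"
proof (induction f rule: radial_L2.abs_induct)
  case (1 u)
  then show ?case
    by (simp add: radial_L2_rel_def)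
qed

text \<open>Radial functions are measurable for free, so domination is all that square integrability
  requires; the origin may be left out because it is a null set.\<close>

lemma radial_L2_fun_le:
  assumes "radial_on_O u" "radial_L2_fun v"
    and "\<And>x. x \<in> O_K \<Longrightarrow> x \<noteq> 0 \<Longrightarrow> cmod (u x) \<le> cmod (v x)"
  shows "radial_L2_fun u"
proof -
  have "AE x in haar. x \<in> O_K \<longrightarrow> (cmod (u x))\<^sup>2 \<le> (cmod (v x))\<^sup>2"
    using AE_haar_nonzero by eventually_elim (auto intro: power_mono assms(3))
  then have "square_integrable_on_O u"
    using assms(2) radial_measurable[OF assms(1)]
    by (intro square_integrable_on_OI[where g = "\<lambda>x. (cmod (v x))\<^sup>2"])
      (auto simp: radial_L2_fun_def square_integrable_on_O_def)
  then show ?thesis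
    using assms(1) by (simp add: radial_L2_fun_def)
qed

text \<open>Radiality passes to \<open>v\<close> although nothing is known about \<open>v 0\<close>:
  the origin is the only point of absolute value zero, so its value is unconstrained.\<close>

lemma
  assumes u: "radial_L2_fun u" and eq: "\<And>x. x \<in> O_K \<Longrightarrow> x \<noteq> 0 \<Longrightarrow> u x = v x"
  shows radial_L2_fun_cong: "radial_L2_fun v"
    and abs_radial_L2_cong: "abs_radial_L2 u = abs_radial_L2 v"
proof -
  have "radial_on_O v"
    unfolding radial_on_O_def
  proof (intro ballI impI)
    fix x y :: 'a assume xy: "x \<in> O_K" "y \<in> O_K" "absK x = absK y"
    show "v x = v y"
    proof (cases "x = 0")
      case True
      then show ?thesis
        using xy absK_eq_0_iff[of y] by simp
    next
      case False
      then have "y \<noteq> 0"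
        using xy absK_eq_0_iff[of x] by auto
      then show ?thesis
        using u xy eq False unfolding radial_L2_fun_def radial_on_O_def by metis
    qed
  qed
  then show v: "radial_L2_fun v"
    using eq by (intro radial_L2_fun_le[OF _ u]) auto
  have "AE x in haar. x \<in> O_K \<longrightarrow> u x = v x"
    using AE_haar_nonzero by eventually_elim (auto intro: eq)
  then have "radial_L2_rel u v"
    using u v by (simp add: radial_L2_rel_def)
  then show "abs_radial_L2 u = abs_radial_L2 v"
    by (rule Quotient_rel_abs[OF Quotient_radial_L2])
qed

lemma abs_radial_L2_add:
  "radial_L2_fun u \<Longrightarrow> radial_L2_fun v \<Longrightarrow>
    abs_radial_L2 u + abs_radial_L2 v = abs_radial_L2 (\<lambda>x. u x + v x)"
  by (simp add: plus_radial_L2.abs_eq radial_L2_rel_def)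

lemma abs_radial_L2_scaleC:
  "radial_L2_fun u \<Longrightarrow> scaleC c (abs_radial_L2 u) = abs_radial_L2 (\<lambda>x. c * u x)"
  by (simp add: scaleC_radial_L2_def radial_scaleC.abs_eq radial_L2_rel_def)

lemma abs_radial_L2_diff:
  assumes "radial_L2_fun u" "radial_L2_fun v"
  shows "abs_radial_L2 u - abs_radial_L2 v = abs_radial_L2 (\<lambda>x. u x - v x)"
  using assms abs_radial_L2_add[of u "\<lambda>x. - 1 * v x"] radial_L2_fun_mult[of v "- 1"]
    abs_radial_L2_scaleC[of v "- 1"]
  by (simp add: minus_radial_L2_def uminus_radial_L2_def scaleC_radial_L2_def)

lemma abs_radial_L2_zero: "abs_radial_L2 (\<lambda>x. 0) = 0"
  by (simp add: zero_radial_L2_def)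

lemma cinner_abs_radial_L2:
  "radial_L2_fun u \<Longrightarrow> radial_L2_fun v \<Longrightarrow>
    cinner (abs_radial_L2 u) (abs_radial_L2 v) = (LINT x:O_K|haar. u x * cnj (v x))"
  by (simp add: cinner_radial_L2_def radial_cinner.abs_eq radial_L2_rel_def)

lemma norm_abs_radial_L2:
  assumes "radial_L2_fun u"
  shows "(norm (abs_radial_L2 u))\<^sup>2 = (LINT x:O_K|haar. (cmod (u x))\<^sup>2)"
  using cinner_self[of "abs_radial_L2 u"] cinner_abs_radial_L2[OF assms assms]
  unfolding radial_cinner_self by (simp only: of_real_eq_iff)

lemma norm_abs_radial_L2_mono:
  fixes u v :: "'a::local_field \<Rightarrow> complex"
  assumes "radial_L2_fun u" "radial_L2_fun v"
    and le: "\<And>x. x \<in> O_K \<Longrightarrow> x \<noteq> 0 \<Longrightarrow> cmod (u x) \<le> cmod (v x)"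
  shows "norm (abs_radial_L2 u) \<le> norm (abs_radial_L2 v)"
proof (rule power2_le_imp_le)
  have "(LINT x:O_K|haar. (cmod (u x))\<^sup>2) \<le> (LINT x:O_K|haar. (cmod (v x))\<^sup>2)"
    unfolding set_lebesgue_integral_def
  proof (rule integral_mono_AE)
    show "AE x in haar. indicator O_K x *\<^sub>R (cmod (u x))\<^sup>2 \<le> indicator O_K x *\<^sub>R (cmod (v x))\<^sup>2"
      using AE_haar_nonzero by eventually_elim (auto simp: indicator_def intro: power_mono le)
  qed (use assms in \<open>auto simp: radial_L2_fun_def square_integrable_on_O_def set_integrable_def\<close>)
  then show "(norm (abs_radial_L2 u))\<^sup>2 \<le> (norm (abs_radial_L2 v))\<^sup>2"
    using assms by (simp add: norm_abs_radial_L2)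
qed simp

section \<open>Norms of bounded functions and of cut-offs\<close>

lemma radial_L2_fun_const: "radial_L2_fun (\<lambda>x :: 'a::local_field. c)"
proof -
  have "radial_on_O (\<lambda>x :: 'a. c)"
    by (simp add: radial_on_O_def)
  moreover have "set_integrable haar (O_K :: 'a set) (\<lambda>x. (cmod c)\<^sup>2)"
    using haar_fin_O[where 'a='a] by (simp add: set_integrable_def)
  ultimately show ?thesis
    using radial_measurable by (auto simp: radial_L2_fun_def square_integrable_on_O_def)
qed

lemma radial_L2_fun_bounded:
  assumes "radial_on_O u" "\<And>x. x \<in> O_K \<Longrightarrow> x \<noteq> 0 \<Longrightarrow> cmod (u x) \<le> B"
  shows "radial_L2_fun u"
  using assms
  by (intro radial_L2_fun_le[OF _ radial_L2_fun_const[of "complex_of_real B"]]) fastforce+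

lemma norm_abs_radial_L2_const:
  "norm (abs_radial_L2 (\<lambda>x :: 'a::local_field. c)) = cmod c"
proof (rule power2_eq_imp_eq)
  have "measure haar (O_K :: 'a set) = 1"
    by (simp add: measure_def emeasure_haar_O)
  then show "(norm (abs_radial_L2 (\<lambda>x :: 'a. c)))\<^sup>2 = (cmod c)\<^sup>2"
    by (simp add: norm_abs_radial_L2[OF radial_L2_fun_const] set_lebesgue_integral_def)
qed simp_all

lemma norm_abs_radial_L2_le:
  assumes "radial_on_O u" "\<And>x. x \<in> O_K \<Longrightarrow> x \<noteq> 0 \<Longrightarrow> cmod (u x) \<le> B" "B \<ge> 0"
  shows "norm (abs_radial_L2 u) \<le> B"
  using norm_abs_radial_L2_mono[OF radial_L2_fun_bounded[OF assms(1,2)]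
      radial_L2_fun_const[of "complex_of_real B"]] assms norm_abs_radial_L2_const
  by (simp add: norm_abs_radial_L2_const)

lemma radial_on_O_indicator:
  "radial_on_O (\<lambda>x. if absK x \<in> V then u x else 0)" if "radial_on_O u"
  using that unfolding radial_on_O_def by metis

lemma radial_L2_fun_indicator:
  "radial_L2_fun (\<lambda>x. if absK x \<in> V then u x else 0)" if "radial_L2_fun u"
  using that by (intro radial_L2_fun_le[OF radial_on_O_indicator that])
    (auto simp: radial_L2_fun_def)

lemma norm_indicator_radial:
  fixes V :: "real set"
  assumes "{x :: 'a::local_field. absK x \<in> V} \<subseteq> O_K" "{x :: 'a::local_field. absK x \<in> V} \<in> sets borel"
  shows "(norm (abs_radial_L2 (\<lambda>x :: 'a. if absK x \<in> V then 1 else 0)))\<^sup>2 =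
    measure haar {x :: 'a. absK x \<in> V}"
proof -
  have "(norm (abs_radial_L2 (\<lambda>x :: 'a. if absK x \<in> V then 1 else 0)))\<^sup>2 =
      (LINT x:(O_K :: 'a set)|haar. (cmod (if absK x \<in> V then 1 else 0))\<^sup>2)"
    by (rule norm_abs_radial_L2[OF radial_L2_fun_indicator[OF radial_L2_fun_const]])
  also have "\<dots> = (LINT x|haar. indicator {x :: 'a. absK x \<in> V} x)"
    unfolding set_lebesgue_integral_def
    using assms(1) by (intro Bochner_Integration.integral_cong) (auto simp: indicator_def)
  finally show ?thesis
    using assms(2) by simp
qed

text \<open>For \<open>x\<close> nonzero the set |y| < |x| is the closed ball of the next smaller
  radius, whose measure is that radius and hence below |x|; for x = 0 it is empty. This is the
  source of the gain of sqrt |x| per integration.\<close>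

lemma norm_indicator_less:
  fixes x :: "'a::local_field"
  assumes "x \<in> O_K"
  shows "norm (abs_radial_L2 (\<lambda>y :: 'a. if absK y < absK x then 1 else 0)) \<le> sqrt (absK x)"
proof (cases "x = 0")
  case True
  then have "(\<lambda>y :: 'a. if absK y < absK x then 1 else 0 :: complex) = (\<lambda>y. 0)"
    using absK_nonneg by (auto simp: fun_eq_iff not_less)
  then show ?thesis
    using absK_nonneg[of x] by (simp add: abs_radial_L2_zero)
next
  case False
  let ?q = "real (residue_card TYPE('a))"
  have q: "?q > 1"
    using residue_card_gt_1[where 'a='a] by simp
  obtain m where m: "x \<in> sphere_K m"
    using assms False by (rule sphere_K_cases)
  have lt: "(1 / ?q) ^ Suc m < (1 / ?q) ^ m"
    using q by (intro power_strict_decreasing) auto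
  have ball: "{y :: 'a. absK y \<in> {..<absK x}} = ball_K (Suc m)"
    using m lt absK_less_imp_le[where 'a='a and n=m]
    by (auto simp: sphere_K_def ball_K_def simp del: power_Suc)
  have "(norm (abs_radial_L2 (\<lambda>y :: 'a. if absK y \<in> {..<absK x} then 1 else 0)))\<^sup>2 =
      measure haar (ball_K (Suc m) :: 'a set)"
    unfolding ball[symmetric] by (rule norm_indicator_radial) (simp_all add: ball ball_K_subset del: lessThan_iff)
  also have "\<dots> \<le> absK x"
    using m lt by (simp add: measure_ball_K sphere_K_def del: power_Suc)
  finally show ?thesis
    by (intro real_le_rsqrt) simp
qed

lemma radial_L2_fun_ln_absK: "radial_L2_fun (\<lambda>x. complex_of_real (c * ln (absK x)))"
proof -
  have rad: "radial_on_O (\<lambda>x :: 'a. complex_of_real (ln (absK x)))"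
    by (simp add: radial_on_O_def)
  then have "radial_L2_fun (\<lambda>x :: 'a. complex_of_real (ln (absK x)))"
    using rad radial_measurable[OF rad] integrable_ln_absK[where 'a='a]
    by (simp add: radial_L2_fun_def square_integrable_on_O_def)
  then show ?thesis
    using radial_L2_fun_mult[of _ "complex_of_real c"] by simp
qed


section \<open>Sections of the kernel and decay of iterates\<close>

definition I01_const :: "'a::local_field itself \<Rightarrow> real" where
  "I01_const _ = (1 - real (residue_card TYPE('a))) /
    (real (residue_card TYPE('a)) * ln (real (residue_card TYPE('a))))"

definition I01_kernel :: "'a::local_field \<Rightarrow> 'a \<Rightarrow> complex" where
  "I01_kernel x y = (if absK y < absK x
    then complex_of_real (I01_const TYPE('a) * (ln (absK x) - ln (absK y))) else 0)"

text \<open>The vector that represents evaluation of \<open>I01 f\<close> at \<open>x\<close> as an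
  inner product. The kernel is real, so the conjugation in the second argument does nothing to
  it.\<close>

definition I01_section :: "'a::local_field \<Rightarrow> 'a radial_L2" where
  "I01_section x = abs_radial_L2 (I01_kernel x)"

text \<open>For |y| < |x| \<le> 1 and \<open>y\<close> nonzero, the difference ln |x| - ln |y| lies
  between 0 and -ln |y|, so one square integrable function dominates all sections at once.\<close>

definition I01_bound :: "'a::local_field itself \<Rightarrow> real" where
  "I01_bound _ = norm (abs_radial_L2 (\<lambda>y :: 'a. complex_of_real (I01_const TYPE('a) * ln (absK y))))"

lemma I01_bound_nonneg: "I01_bound TYPE('a::local_field) \<ge> 0"
  by (simp add: I01_bound_def)

lemma I01_kernel_le:
  fixes x y :: "'a::local_field"
  assumes "x \<in> O_K" "y \<noteq> 0"
  shows "cmod (I01_kernel x y) \<le> cmod (complex_of_real (I01_const TYPE('a) * ln (absK y)))"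
proof (cases "absK y < absK x")
  case True
  have "0 < absK y"
    using assms(2) absK_nonneg[of y] absK_eq_0_iff[of y] by (simp add: less_le)
  then have "ln (absK y) \<le> ln (absK x)" "ln (absK x) \<le> 0"
    using True assms(1) by (auto simp: O_K_def)
  then have "\<bar>ln (absK x) - ln (absK y)\<bar> \<le> \<bar>ln (absK y)\<bar>"
    by linarith
  then show ?thesis
    using True unfolding I01_kernel_def by (simp add: norm_mult abs_mult mult_left_mono del: of_real_mult)
qed (simp add: I01_kernel_def)

lemma radial_L2_fun_I01_kernel:
  assumes "(x :: 'a::local_field) \<in> O_K"
  shows "radial_L2_fun (I01_kernel x)"
  using assms by (intro radial_L2_fun_le[OF _ radial_L2_fun_ln_absK[of "I01_const TYPE('a)"]] I01_kernel_le)
    (simp_all add: radial_on_O_def I01_kernel_def)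

lemma norm_I01_section:
  fixes x :: "'a::local_field"
  assumes "x \<in> O_K"
  shows "norm (I01_section x) \<le> I01_bound TYPE('a)"
  unfolding I01_section_def I01_bound_def
  using assms by (intro norm_abs_radial_L2_mono radial_L2_fun_I01_kernel radial_L2_fun_ln_absK I01_kernel_le)

lemma I01_fun_eq:
  fixes u :: "'a::local_field \<Rightarrow> complex"
  assumes "radial_L2_fun u" "x \<in> O_K"
  shows "I01_fun u x = cinner (abs_radial_L2 u) (I01_section x)"
proof -
  have "I01_fun u x = complex_of_real (I01_const TYPE('a)) *
      (LINT y:{y. absK y < absK x}|haar. complex_of_real (ln (absK x) - ln (absK y)) * u y)"
    by (simp only: I01_fun_def I01_const_def)
  also have "\<dots> = (LINT y|haar. complex_of_real (I01_const TYPE('a)) *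
        (indicator {y. absK y < absK x} y *\<^sub>R (complex_of_real (ln (absK x) - ln (absK y)) * u y)))"
    by (simp only: set_lebesgue_integral_def integral_mult_right_zero)
  also have "\<dots> = (LINT y:O_K|haar. u y * cnj (I01_kernel x y))"
    unfolding set_lebesgue_integral_def using assms(2)
    by (intro Bochner_Integration.integral_cong)
      (auto simp: I01_kernel_def indicator_def O_K_def)
  finally show ?thesis
    using assms by (simp add: I01_section_def cinner_abs_radial_L2 radial_L2_fun_I01_kernel)
qed

lemma
  fixes f :: "'a::local_field radial_L2"
  shows radial_L2_fun_I01_section: "radial_L2_fun (\<lambda>x. cinner f (I01_section x))"
    and I01_eq: "I01 f = abs_radial_L2 (\<lambda>x. cinner f (I01_section x))"
proof -
  obtain u where u: "radial_L2_fun u" "f = abs_radial_L2 u"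
    by (rule radial_L2_cases)
  have eq: "I01_fun u x = cinner f (I01_section x)" if "x \<in> O_K" for x
    using I01_fun_eq[OF u(1) that] u(2) by simp
  show "radial_L2_fun (\<lambda>x. cinner f (I01_section x))"
    by (rule radial_L2_fun_cong[OF radial_L2_fun_I01[OF u(1)] eq])
  have "I01 f = abs_radial_L2 (I01_fun u)"
    using u by (simp add: I01.abs_eq radial_L2_rel_def)
  also have "\<dots> = abs_radial_L2 (\<lambda>x. cinner f (I01_section x))"
    by (rule abs_radial_L2_cong[OF radial_L2_fun_I01[OF u(1)] eq])
  finally show "I01 f = abs_radial_L2 (\<lambda>x. cinner f (I01_section x))" .
qed

lemma cmod_I01_section_le:
  fixes f :: "'a::local_field radial_L2"
  assumes "x \<in> O_K"
  shows "cmod (cinner f (I01_section x)) \<le> I01_bound TYPE('a) * norm f"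
proof -
  have "cmod (cinner f (I01_section x)) \<le> norm f * norm (I01_section x)"
    by (rule Cauchy_Schwarz_cinner)
  also have "\<dots> \<le> norm f * I01_bound TYPE('a)"
    using norm_I01_section[OF assms] by (intro mult_left_mono) auto
  finally show ?thesis
    by (simp add: mult.commute)
qed

lemma norm_I01_le:
  fixes f :: "'a::local_field radial_L2"
  shows "norm (I01 f) \<le> I01_bound TYPE('a) * norm f"
  unfolding I01_eq using radial_L2_fun_I01_section[of f] I01_bound_nonneg[where 'a='a]
  by (intro norm_abs_radial_L2_le cmod_I01_section_le) (auto simp: radial_L2_fun_def)

lemma bounded_clinear_I01: "bounded_clinear (I01 :: 'a::local_field radial_L2 \<Rightarrow> 'a radial_L2)"
proof -
  have scale: "I01 (scaleC c f) = scaleC c (I01 f)" for c and f :: "'a radial_L2"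
    unfolding I01_eq abs_radial_L2_scaleC[OF radial_L2_fun_I01_section] cinner_scaleC_left ..
  have add: "I01 (f + g) = I01 f + I01 g" for f g :: "'a radial_L2"
    unfolding I01_eq abs_radial_L2_add[OF radial_L2_fun_I01_section radial_L2_fun_I01_section]
      cinner_add_left ..
  show ?thesis
    unfolding bounded_clinear_def
    using bounded_linear_intro[of I01, OF add _ , of "I01_bound TYPE('a)"] norm_I01_le[where 'a='a]
    by (simp add: scale scaleR_scaleC mult.commute)
qed

text \<open>Integration over the ball \<open>{y. absK y < absK x}\<close> gains a factor \<open>sqrt (absK x)\<close> from the
  measure of that ball; moreover \<open>absK y\<close> is at most \<open>absK x / 2\<close> on it. The gain accumulates
  under iteration.\<close>

lemma I01_section_decay:
  fixes u :: "'a::local_field \<Rightarrow> complex"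
  assumes u: "radial_L2_fun u" and x: "x \<in> O_K"
    and B: "B \<ge> 0" "\<And>y. y \<in> O_K \<Longrightarrow> cmod (u y) \<le> B * sqrt (absK y) ^ j"
  shows "cmod (cinner (abs_radial_L2 u) (I01_section x)) \<le>
    B * (I01_bound TYPE('a) * sqrt (1 / 2) ^ j) * sqrt (absK x) ^ Suc j"
proof -
  \<comment> \<open>An upper bound for \<open>B * sqrt (absK y) ^ j\<close> as \<open>y\<close>
    ranges over |y| \<le> |x| / 2.\<close>
  define c where "c = B * sqrt (absK x / 2) ^ j"
  have "c \<ge> 0"
    using B absK_nonneg[of x] by (simp add: c_def)
  \<comment> \<open>The section vanishes outside |y| < |x|, so cutting \<open>u\<close> off there
    leaves the inner product unchanged, while Cauchy-Schwarz now pays only for the mass of that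
    ball.\<close>
  define g where "g y = (if absK y \<in> {..<absK x} then u y else 0)" for y
  have g: "radial_L2_fun g"
    unfolding g_def by (rule radial_L2_fun_indicator[OF u])
  have half: "absK y \<le> absK x / 2" if "absK y < absK x" for y :: 'a
  proof -
    have q: "real (residue_card TYPE('a)) \<ge> 2"
      using residue_card_gt_1[where 'a='a] by simp
    have "x \<noteq> 0"
      using that absK_nonneg[of y] by auto
    then obtain m where m: "x \<in> sphere_K m"
      by (rule sphere_K_cases[OF x])
    have "absK y \<le> absK x / real (residue_card TYPE('a))"
      using absK_less_imp_le[where n = m and y = y] that m by (simp add: sphere_K_def)
    also have "\<dots> \<le> absK x / 2"
      using q absK_nonneg[of x] by (intro divide_left_mono) auto
    finally show ?thesis .
  qed
  have "cinner (abs_radial_L2 u) (I01_section x) = cinner (abs_radial_L2 g) (I01_section x)"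
    unfolding I01_section_def cinner_abs_radial_L2[OF u radial_L2_fun_I01_kernel[OF x]]
      cinner_abs_radial_L2[OF g radial_L2_fun_I01_kernel[OF x]]
    by (rule arg_cong[of _ _ "set_lebesgue_integral haar O_K"])
      (auto simp: g_def I01_kernel_def fun_eq_iff)
  also have "cmod \<dots> \<le> norm (abs_radial_L2 g) * norm (I01_section x)"
    by (rule Cauchy_Schwarz_cinner)
  also have "\<dots> \<le> (c * sqrt (absK x)) * I01_bound TYPE('a)"
  proof (intro mult_mono norm_I01_section x)
    let ?h = "\<lambda>y :: 'a. if absK y \<in> {..<absK x} then 1 else 0 :: complex"
    have h: "radial_L2_fun ?h"
      by (rule radial_L2_fun_indicator[OF radial_L2_fun_const])
    have "norm (abs_radial_L2 g) \<le> norm (abs_radial_L2 (\<lambda>y. complex_of_real c * ?h y))"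
    proof (rule norm_abs_radial_L2_mono[OF g radial_L2_fun_mult[OF h]])
      fix y :: 'a assume y: "y \<in> O_K"
      have "cmod (u y) \<le> c" if "absK y < absK x"
      proof -
        have "cmod (u y) \<le> B * sqrt (absK y) ^ j"
          using B y by blast
        also have "\<dots> \<le> c"
          unfolding c_def using half[OF that] B absK_nonneg[of y]
          by (intro mult_left_mono power_mono real_sqrt_le_mono) auto
        finally show ?thesis .
      qed
      then show "cmod (g y) \<le> cmod (complex_of_real c * ?h y)"
        using \<open>c \<ge> 0\<close> by (simp add: g_def)
    qed
    also have "\<dots> = c * norm (abs_radial_L2 ?h)"
      using \<open>c \<ge> 0\<close> by (simp only: abs_radial_L2_scaleC[OF h, symmetric] norm_scaleC) simp
    also have "\<dots> \<le> c * sqrt (absK x)"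
      using norm_indicator_less[OF x] \<open>c \<ge> 0\<close> by (intro mult_left_mono) simp_all
    finally show "norm (abs_radial_L2 g) \<le> c * sqrt (absK x)" .
  qed (use \<open>c \<ge> 0\<close> absK_nonneg[of x] in auto)
  also have "\<dots> = B * (I01_bound TYPE('a) * sqrt (1 / 2) ^ j) * sqrt (absK x) ^ Suc j"
    by (simp add: c_def real_sqrt_divide power_divide field_simps)
  finally show ?thesis .
qed

text \<open>With K = \<open>I01_bound T\<close> the value at k >= 1 is K^k 2^(-(k-1)(k-2)/4). The
  first application meets a vector without pointwise bounds and produces only a uniform one;
  pointwise decay starts with the second, which shifts the recursion.\<close>

fun I01_power_bound :: "'a::local_field itself \<Rightarrow> nat \<Rightarrow> real" where
  "I01_power_bound T 0 = 1"
| "I01_power_bound T (Suc 0) = I01_bound T"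
| "I01_power_bound T (Suc (Suc k)) = I01_power_bound T (Suc k) * (I01_bound T * sqrt (1 / 2) ^ k)"

lemma I01_power_bound_nonneg: "I01_power_bound T k \<ge> 0"
  by (induction T k rule: I01_power_bound.induct) (auto simp: I01_bound_def)

text \<open>Decay is a property of functions, not of classes, so the induction carries a
  representative and starts at the first iterate.\<close>

lemma I01_power_decay:
  fixes f :: "'a::local_field radial_L2"
  shows "\<exists>u. radial_L2_fun u \<and> (I01 ^^ Suc k) f = abs_radial_L2 u \<and>
    (\<forall>x\<in>O_K. cmod (u x) \<le> I01_power_bound TYPE('a) (Suc k) * norm f * sqrt (absK x) ^ k)"
proof (induction k)
  case 0
  show ?case
    using radial_L2_fun_I01_section[of f] cmod_I01_section_le[of _ f] by (auto simp: I01_eq)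
next
  case (Suc k)
  then obtain u where u: "radial_L2_fun u" "(I01 ^^ Suc k) f = abs_radial_L2 u"
    "\<And>x. x \<in> O_K \<Longrightarrow> cmod (u x) \<le> I01_power_bound TYPE('a) (Suc k) * norm f * sqrt (absK x) ^ k"
    by blast
  have "(I01 ^^ Suc (Suc k)) f = abs_radial_L2 (\<lambda>x. cinner (abs_radial_L2 u) (I01_section x))"
    using u(2) I01_eq[of "abs_radial_L2 u"] by simp
  moreover have "cmod (cinner (abs_radial_L2 u) (I01_section x)) \<le>
      I01_power_bound TYPE('a) (Suc (Suc k)) * norm f * sqrt (absK x) ^ Suc k" if "x \<in> O_K" for x
    using I01_section_decay[OF u(1) that _ u(3)] I01_power_bound_nonneg[where 'a='a and k = "Suc k"]
    by (simp add: mult_ac)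
  ultimately show ?case
    using radial_L2_fun_I01_section[of "abs_radial_L2 u"] by blast
qed

lemma norm_I01_power:
  fixes f :: "'a::local_field radial_L2"
  shows "norm ((I01 ^^ k) f) \<le> I01_power_bound TYPE('a) k * norm f"
proof (cases k)
  case (Suc l)
  obtain u where u: "radial_L2_fun u" "(I01 ^^ Suc l) f = abs_radial_L2 u"
    "\<And>x. x \<in> O_K \<Longrightarrow> cmod (u x) \<le> I01_power_bound TYPE('a) (Suc l) * norm f * sqrt (absK x) ^ l"
    using I01_power_decay by blast
  have nonneg: "I01_power_bound TYPE('a) (Suc l) * norm f \<ge> 0"
    using I01_power_bound_nonneg[where 'a='a and k = "Suc l"] by (intro mult_nonneg_nonneg) auto
  have "cmod (u x) \<le> I01_power_bound TYPE('a) (Suc l) * norm f" if "x \<in> O_K" for x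
  proof -
    have "sqrt (absK x) ^ l \<le> 1"
      using that absK_nonneg[of x] by (intro power_le_one) (auto simp: O_K_def)
    then have "I01_power_bound TYPE('a) (Suc l) * norm f * sqrt (absK x) ^ l
        \<le> I01_power_bound TYPE('a) (Suc l) * norm f"
      using nonneg by (rule mult_left_le)
    then show ?thesis
      using u(3)[OF that] by linarith
  qed
  then show ?thesis
    unfolding Suc u(2) using u(1) nonneg by (intro norm_abs_radial_L2_le) (auto simp: radial_L2_fun_def)
qed simp

lemma summable_I01_power_bound: "summable (\<lambda>k. r ^ k * I01_power_bound TYPE('a::local_field) k)"
proof -
  let ?K = "I01_bound TYPE('a)"
  have "(\<lambda>k. \<bar>r\<bar> * ?K * sqrt (1 / 2) ^ k) \<longlonglongrightarrow> \<bar>r\<bar> * ?K * 0"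
    by (intro tendsto_intros LIMSEQ_realpow_zero) auto
  then have "\<forall>\<^sub>F k in sequentially. \<bar>r\<bar> * ?K * sqrt (1 / 2) ^ k < 1 / 2"
    by (rule order_tendstoD) simp
  then obtain N where N: "\<And>k. k \<ge> N \<Longrightarrow> \<bar>r\<bar> * ?K * sqrt (1 / 2) ^ k < 1 / 2"
    unfolding eventually_sequentially by blast
  show ?thesis
  \<comment> \<open>The ratio from n = \<open>Suc k\<close> to \<open>Suc n\<close> carries the
    exponent \<open>k\<close>, hence the threshold \<open>Suc N\<close>.\<close>
  proof (rule summable_ratio_test[of "1 / 2" "Suc N"])
    fix n assume "n \<ge> Suc N"
    then obtain k where k: "n = Suc k" "k \<ge> N"
      by (cases n) auto
    let ?C = "I01_power_bound TYPE('a)"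
    have "norm (r ^ Suc n * ?C (Suc n)) = (\<bar>r\<bar> * ?K * sqrt (1 / 2) ^ k) * norm (r ^ n * ?C n)"
      using I01_bound_nonneg[where 'a='a] by (simp add: k abs_mult power_abs mult_ac)
    also have "\<dots> \<le> 1 / 2 * norm (r ^ n * ?C n)"
      using N[OF k(2)] by (intro mult_right_mono) auto
    finally show "norm (r ^ Suc n * ?C (Suc n)) \<le> 1 / 2 * norm (r ^ n * ?C n)" .
  qed simp
qed


section \<open>The basis of sphere indicators\<close>

definition sphere_vec :: "nat \<Rightarrow> 'a::local_field radial_L2" where
  "sphere_vec n = abs_radial_L2 (\<lambda>x. if x \<in> sphere_K n then 1 else 0)"

definition sphere_pt :: "nat \<Rightarrow> 'a::local_field" where
  "sphere_pt n = (SOME x. x \<in> sphere_K n)"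

abbreviation sphere_mass :: "'a::local_field itself \<Rightarrow> nat \<Rightarrow> real" where
  "sphere_mass _ n \<equiv> measure haar (sphere_K n :: 'a set)"

lemma sphere_pt: "sphere_pt n \<in> sphere_K n"
  using sphere_K_nonempty unfolding sphere_pt_def by (metis someI)

lemma radial_eq_sphere_pt:
  fixes u :: "'a::local_field \<Rightarrow> complex"
  assumes "radial_on_O u" "x \<in> sphere_K n"
  shows "u x = u (sphere_pt n)"
proof -
  have "x \<in> O_K" "sphere_pt n \<in> (O_K :: 'a set)"
    using assms(2) by (auto intro: subsetD[OF sphere_K_subset] sphere_pt)
  moreover have "absK x = absK (sphere_pt n :: 'a)"
    using assms(2) sphere_pt[of n, where 'a='a] by (simp add: sphere_K_def)
  ultimately show ?thesis
    using assms(1) unfolding radial_on_O_def by blast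
qed

lemma radial_L2_fun_sphere:
  "radial_L2_fun (\<lambda>x. if x \<in> sphere_K n then u x else 0)" if "radial_L2_fun u"
  for u :: "'a::local_field \<Rightarrow> complex"
  using radial_L2_fun_indicator[OF that, of "{(1 / real (residue_card TYPE('a))) ^ n}"]
  by (simp add: sphere_K_def)

lemma cinner_sphere_vec:
  fixes u :: "'a::local_field \<Rightarrow> complex"
  assumes u: "radial_L2_fun u"
  shows "cinner (abs_radial_L2 u) (sphere_vec n) = u (sphere_pt n) * sphere_mass TYPE('a) n"
proof -
  have "emeasure haar (sphere_K n :: 'a set) \<le> emeasure haar (O_K :: 'a set)"
    by (intro emeasure_mono sphere_K_subset) simp
  then have fin: "emeasure haar (sphere_K n :: 'a set) < \<infinity>"
    using haar_fin_O by (rule le_less_trans)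
  have "cinner (abs_radial_L2 u) (sphere_vec n) =
      (LINT x:O_K|haar. u x * cnj (if x \<in> sphere_K n then 1 else 0))"
    unfolding sphere_vec_def
    by (intro cinner_abs_radial_L2 u radial_L2_fun_sphere radial_L2_fun_const)
  also have "\<dots> = (LINT x|haar. indicator (sphere_K n :: 'a set) x *\<^sub>R u (sphere_pt n))"
    unfolding set_lebesgue_integral_def
    using radial_eq_sphere_pt[of u _ n] u sphere_K_subset[of n, where 'a='a]
    by (intro Bochner_Integration.integral_cong) (auto simp: indicator_def radial_L2_fun_def)
  also have "\<dots> = sphere_mass TYPE('a) n *\<^sub>R u (sphere_pt n)"
    using fin by (subst integral_scaleR_left) auto
  finally show ?thesis
    by (simp add: scaleR_conv_of_real)
qed

lemma sphere_pt_in_iff: "sphere_pt m \<in> sphere_K n \<longleftrightarrow> m = n"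
  using sphere_pt sphere_K_disjoint by blast

lemma cinner_sphere_vec_sphere_vec:
  "cinner (sphere_vec m) (sphere_vec n :: 'a::local_field radial_L2) =
    (if m = n then complex_of_real (sphere_mass TYPE('a) n) else 0)"
  using cinner_sphere_vec[OF radial_L2_fun_sphere[OF radial_L2_fun_const], of m 1 n, where 'a='a]
  by (simp add: sphere_vec_def sphere_pt_in_iff)

text \<open>The cut-offs to shrinking balls telescope, since consecutive ones differ by one sphere.
  The exact remainder serves both convergence for a fixed \<open>u\<close> and uniform convergence
  over bounded sequences.\<close>

lemma partial_sum_sphere_vec:
  fixes u :: "'a::local_field \<Rightarrow> complex"
  assumes u: "radial_L2_fun u"
  shows "(\<Sum>n<N. scaleC (u (sphere_pt n)) (sphere_vec n)) =
    abs_radial_L2 u - abs_radial_L2 (\<lambda>x. if absK x \<in> {..(1 / real (residue_card TYPE('a))) ^ N} then u x else 0)"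
    (is "_ = _ - abs_radial_L2 (?t N)")
proof (induction N)
  case 0
  have "abs_radial_L2 u = abs_radial_L2 (?t 0)"
    by (rule abs_radial_L2_cong[OF u]) (simp add: O_K_def)
  then show ?case
    by simp
next
  case (Suc N)
  let ?q = "real (residue_card TYPE('a))"
  have t: "radial_L2_fun (?t n)" for n
    by (rule radial_L2_fun_indicator[OF u])
  have lt: "(1 / ?q) ^ Suc N < (1 / ?q) ^ N"
    using residue_card_gt_1[where 'a='a] by (intro power_strict_decreasing) auto
  have "scaleC (u (sphere_pt N)) (sphere_vec N) =
      abs_radial_L2 (\<lambda>x. u (sphere_pt N) * (if x \<in> sphere_K N then 1 else 0))"
    unfolding sphere_vec_def
    by (intro abs_radial_L2_scaleC radial_L2_fun_sphere radial_L2_fun_const)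
  also have "\<dots> = abs_radial_L2 (\<lambda>x. ?t N x - ?t (Suc N) x)"
  proof (rule abs_radial_L2_cong)
    show "radial_L2_fun (\<lambda>x. u (sphere_pt N) * (if x \<in> sphere_K N then 1 else 0))"
      by (intro radial_L2_fun_mult radial_L2_fun_sphere radial_L2_fun_const)
    fix x :: 'a
    have "x \<in> sphere_K N \<longleftrightarrow> absK x \<le> (1 / ?q) ^ N \<and> \<not> absK x \<le> (1 / ?q) ^ Suc N"
      using absK_less_imp_le[of x N] lt unfolding sphere_K_def by fastforce
    moreover have "u (sphere_pt N) = u x" if "x \<in> sphere_K N"
      using radial_eq_sphere_pt[OF _ that, of u] u by (simp add: radial_L2_fun_def)
    ultimately show "u (sphere_pt N) * (if x \<in> sphere_K N then 1 else 0) = ?t N x - ?t (Suc N) x"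
      using lt by (auto simp del: power_Suc)
  qed
  also have "\<dots> = abs_radial_L2 (?t N) - abs_radial_L2 (?t (Suc N))"
    by (rule abs_radial_L2_diff[OF t t, symmetric])
  finally have step: "scaleC (u (sphere_pt N)) (sphere_vec N) =
      abs_radial_L2 (?t N) - abs_radial_L2 (?t (Suc N))" .
  show ?case
    unfolding sum.lessThan_Suc Suc step by simp
qed

text \<open>The remainders tend to zero at every nonzero point and are dominated by
  \<open>u\<close>, so dominated convergence applies to their squares.\<close>

lemma sphere_vec_sums:
  fixes u :: "'a::local_field \<Rightarrow> complex"
  assumes u: "radial_L2_fun u"
  shows "(\<lambda>n. scaleC (u (sphere_pt n)) (sphere_vec n)) sums abs_radial_L2 u"
proof -
  let ?r = "1 / real (residue_card TYPE('a))"
  let ?t = "\<lambda>N x. if absK x \<in> {..?r ^ N} then u x else 0"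
  have r: "0 < ?r" "?r < 1"
    using residue_card_gt_1[where 'a='a] by auto
  have lim_r: "(\<lambda>N. ?r ^ N) \<longlonglongrightarrow> 0"
    using r by (intro LIMSEQ_realpow_zero) auto
  have t: "radial_L2_fun (?t n)" for n
    by (rule radial_L2_fun_indicator[OF u])
  have int: "integrable haar (\<lambda>x. indicator O_K x *\<^sub>R (cmod (f x))\<^sup>2)" if "radial_L2_fun f" for f :: "'a \<Rightarrow> complex"
    using that by (simp add: radial_L2_fun_def square_integrable_on_O_def set_integrable_def)
  have "(\<lambda>N. LINT x|haar. indicator O_K x *\<^sub>R (cmod (?t N x))\<^sup>2) \<longlonglongrightarrow> (LINT x|(haar :: 'a measure). 0)"
  proof (rule integral_dominated_convergence)
    show "AE x in haar. (\<lambda>N. indicator O_K x *\<^sub>R (cmod (?t N x))\<^sup>2) \<longlonglongrightarrow> 0"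
      using AE_haar_nonzero
    proof eventually_elim
      fix x :: 'a assume "x \<noteq> 0"
      then have "absK x > 0"
        using absK_nonneg[of x] absK_eq_0_iff[of x] by (simp add: less_le)
      then have "\<forall>\<^sub>F N in sequentially. ?r ^ N < absK x"
        by (rule order_tendstoD(2)[OF lim_r])
      then have "\<forall>\<^sub>F N in sequentially. indicator O_K x *\<^sub>R (cmod (?t N x))\<^sup>2 = 0"
        by eventually_elim auto
      then show "(\<lambda>N. indicator O_K x *\<^sub>R (cmod (?t N x))\<^sup>2) \<longlonglongrightarrow> 0"
        by (rule tendsto_eventually)
    qed
    show "AE x in haar. norm (indicator O_K x *\<^sub>R (cmod (?t N x))\<^sup>2) \<le> indicator O_K x *\<^sub>R (cmod (u x))\<^sup>2" for N
      by (auto simp: indicator_def)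
    show "integrable haar (\<lambda>x. indicator O_K x *\<^sub>R (cmod (u x))\<^sup>2)"
      by (rule int[OF u])
    show "(\<lambda>x. indicator O_K x *\<^sub>R (cmod (?t N x))\<^sup>2) \<in> borel_measurable haar" for N
      by (rule borel_measurable_integrable[OF int[OF t]])
  qed simp
  then have "(\<lambda>N. (norm (abs_radial_L2 (?t N)))\<^sup>2) \<longlonglongrightarrow> 0"
    by (simp only: norm_abs_radial_L2[OF t] set_lebesgue_integral_def integral_zero)
  then have "(\<lambda>N. sqrt ((norm (abs_radial_L2 (?t N)))\<^sup>2)) \<longlonglongrightarrow> sqrt 0"
    by (rule tendsto_real_sqrt)
  then have "(\<lambda>N. abs_radial_L2 (?t N)) \<longlonglongrightarrow> 0"
    by (simp add: tendsto_norm_zero_iff)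
  then have "(\<lambda>N. abs_radial_L2 u - abs_radial_L2 (?t N)) \<longlonglongrightarrow> abs_radial_L2 u - 0"
    by (intro tendsto_intros)
  then show ?thesis
    unfolding sums_def partial_sum_sphere_vec[OF u] by simp
qed

text \<open>\<open>bounded_linear\<close> means real-linear, so complex multiples of the sphere
  vectors have to be tested as well. In return, maps that are linear or antilinear over the complex
  numbers are treated alike.\<close>

lemma bounded_linear_eq_0_on_sphere_vec:
  assumes L: "bounded_linear L" and 0: "\<And>c n. L (scaleC c (sphere_vec n)) = 0"
  shows "L f = 0"
proof -
  obtain u where u: "radial_L2_fun u" "f = abs_radial_L2 u"
    by (rule radial_L2_cases)
  have "(\<lambda>n. L (scaleC (u (sphere_pt n)) (sphere_vec n))) sums L f"
    unfolding u(2) by (rule bounded_linear.sums[OF L sphere_vec_sums[OF u(1)]])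
  then show ?thesis
    using 0 sums_unique2[OF _ sums_zero] by simp
qed

lemma sphere_vec_eqI:
  assumes "\<And>n. cinner f (sphere_vec n) = cinner g (sphere_vec n)"
  shows "f = g"
proof -
  have "cinner (sphere_vec n) (f - g) = 0" for n
    using assms[of n] cinner_commute[of "sphere_vec n" "f - g"] by (simp add: cinner_diff_left)
  then have "cinner (f - g) (f - g) = 0"
    using bounded_linear_eq_0_on_sphere_vec[OF bounded_linear_cinner_left[of "f - g"]]
    by (simp add: cinner_scaleC_left)
  then show ?thesis
    by (simp add: cinner_self)
qed

lemma ex_orthonormal_basis:
  "\<exists>E :: 'a::local_field radial_L2 set. orthonormal_basis E"
proof -
  let ?w = "sphere_mass TYPE('a)"
  define e where "e n = scaleC (1 / sqrt (?w n)) (sphere_vec n :: 'a radial_L2)" for n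
  have w: "?w n > 0" for n
    by (rule measure_sphere_K_pos)
  have e: "cinner (e m) (e n) = (if m = n then 1 else 0)" for m n
  proof -
    have "complex_of_real (sqrt (?w n)) * complex_of_real (sqrt (?w n)) = complex_of_real (?w n)"
      using w[of n] by (simp flip: of_real_mult)
    then show ?thesis
      using w[of n] by (simp add: e_def cinner_scaleC_left cinner_scaleC_right cinner_sphere_vec_sphere_vec)
  qed
  have "f \<in> closure (cspan (range e))" for f
  proof -
    obtain u where u: "radial_L2_fun u" "f = abs_radial_L2 u"
      by (rule radial_L2_cases)
    have sc: "scaleC c (sphere_vec n) = scaleC (c * sqrt (?w n)) (e n)" for c n
      using w[of n] by (simp add: e_def scaleC_scaleC)
    have "(\<Sum>n<N. scaleC (u (sphere_pt n)) (sphere_vec n)) \<in> cspan (range e)" for N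
      unfolding sc by (intro complex_vector.span_sum complex_vector.span_scale complex_vector.span_base) simp
    then show ?thesis
      using sphere_vec_sums[OF u(1)] unfolding closure_sequential sums_def u(2)
      by (intro exI conjI allI)
  qed
  moreover have "cinner x y = (if x = y then 1 else 0)" if "x \<in> range e" "y \<in> range e" for x y
    using that e by (metis imageE zero_neq_one)
  ultimately have "orthonormal_basis (range e)"
    unfolding orthonormal_basis_def by blast
  then show ?thesis
    by blast
qed


section \<open>Compactness\<close>

text \<open>At the origin the description picks an unspecified index. This is harmless: the origin
  is a null set, and the index still depends on \<open>absK x\<close> only.\<close>

definition sphere_index :: "'a::local_field \<Rightarrow> nat" where
  "sphere_index x = (THE n. x \<in> sphere_K n)"

lemma sphere_index_sphere_pt: "sphere_index (sphere_pt n) = n"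
  unfolding sphere_index_def by (rule the_equality) (simp_all add: sphere_pt sphere_pt_in_iff)

lemma radial_on_O_sphere_index: "radial_on_O (\<lambda>x. s (sphere_index x))"
  by (simp add: radial_on_O_def sphere_index_def sphere_K_def)

text \<open>By Tychonoff, the sequences bounded by \<open>K\<close> form a compact set in the product topology, and
  there the radial function depends continuously in \<open>L\<^sup>2\<close> on its values on the spheres.\<close>

lemma compact_bounded_radial:
  "compact ((\<lambda>s. abs_radial_L2 (\<lambda>x :: 'a::local_field. s (sphere_index x))) ` {s. \<forall>n. cmod (s n) \<le> K})"
  (is "compact (?F ` ?P)")
proof (rule compact_continuous_image)
  have P: "?P = PiE UNIV (\<lambda>n. cball 0 K)"
    by (auto simp: PiE_UNIV_domain)
  show "compact ?P"
    unfolding P compactin_euclidean_iff[symmetric] euclidean_product_topology[symmetric] compactin_PiE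
    by (simp add: compactin_euclidean_iff)
  let ?r = "1 / real (residue_card TYPE('a))"
  have r: "0 < ?r" "?r < 1"
    using residue_card_gt_1[where 'a='a] by auto
  have fn: "radial_L2_fun (\<lambda>x :: 'a. s (sphere_index x))" if "s \<in> ?P" for s
    using that by (intro radial_L2_fun_bounded[OF radial_on_O_sphere_index]) auto
  show "continuous_on ?P ?F"
  \<comment> \<open>A partial sum sees finitely many coordinates, so it is continuous for the
    product topology. The remainder lives on \<open>ball_K N\<close> and has norm at most |K|
    q^(-N/2), uniformly in the sequence.\<close>
  proof (rule uniform_limit_theorem)
    let ?S = "\<lambda>N s. \<Sum>n<N. scaleC (s n) (sphere_vec n :: 'a radial_L2)"
    show "\<forall>\<^sub>F N in sequentially. continuous_on ?P (?S N)"
      by (intro always_eventually allI continuous_on_sum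
          bounded_linear.continuous_on[OF bounded_linear_scaleC_left]
          continuous_on_subset[OF continuous_on_product_coordinates subset_UNIV])
    have lim: "(\<lambda>N. \<bar>K\<bar> * sqrt (?r ^ N)) \<longlonglongrightarrow> \<bar>K\<bar> * sqrt 0"
      using r by (intro tendsto_intros LIMSEQ_realpow_zero) auto
    show "uniform_limit ?P ?S ?F sequentially"
      unfolding uniform_limit_iff
    proof (intro allI impI)
      fix d :: real assume "d > 0"
      then have "\<forall>\<^sub>F N in sequentially. \<bar>K\<bar> * sqrt (?r ^ N) < d"
        using order_tendstoD(2)[OF lim] by simp
      then show "\<forall>\<^sub>F N in sequentially. \<forall>s\<in>?P. dist (?S N s) (?F s) < d"
      proof (eventually_elim, intro ballI)
        fix N s assume N: "\<bar>K\<bar> * sqrt (?r ^ N) < d" and s: "s \<in> ?P"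
        let ?t = "\<lambda>x :: 'a. if absK x \<in> {..?r ^ N} then s (sphere_index x) else 0"
        let ?h = "\<lambda>x :: 'a. if absK x \<in> {..?r ^ N} then 1 else 0 :: complex"
        have h: "radial_L2_fun ?h"
          by (rule radial_L2_fun_indicator[OF radial_L2_fun_const])
        have ball: "{x :: 'a. absK x \<in> {..?r ^ N}} = ball_K N"
          by (simp add: ball_K_def)
        have "(norm (abs_radial_L2 ?h))\<^sup>2 = measure haar (ball_K N :: 'a set)"
          unfolding ball[symmetric]
          by (rule norm_indicator_radial) (simp_all add: ball ball_K_subset del: atMost_iff)
        then have nh: "norm (abs_radial_L2 ?h) = sqrt (?r ^ N)"
          by (intro real_sqrt_unique[symmetric]) (simp_all add: measure_ball_K)
        have "dist (?S N s) (?F s) = norm (abs_radial_L2 ?t)"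
          using partial_sum_sphere_vec[OF fn[OF s], of N] by (simp add: sphere_index_sphere_pt dist_norm)
        also have "\<dots> \<le> norm (abs_radial_L2 (\<lambda>x. complex_of_real K * ?h x))"
        proof (rule norm_abs_radial_L2_mono[OF radial_L2_fun_indicator[OF fn[OF s]] radial_L2_fun_mult[OF h]])
          fix x :: 'a
          have "cmod (s (sphere_index x)) \<le> \<bar>K\<bar>"
            using s by (auto intro: order_trans[OF _ abs_ge_self])
          then show "cmod (?t x) \<le> cmod (complex_of_real K * ?h x)"
            by simp
        qed
        also have "\<dots> = \<bar>K\<bar> * sqrt (?r ^ N)"
          by (simp only: abs_radial_L2_scaleC[OF h, symmetric] norm_scaleC nh norm_of_real)
        finally show "dist (?S N s) (?F s) < d"
          using N by simp
      qed
    qed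
  qed simp
qed

lemma compact_operator_I01: "compact_operator (I01 :: 'a::local_field radial_L2 \<Rightarrow> 'a radial_L2)"
proof -
  let ?K = "I01_bound TYPE('a)"
  let ?D = "(\<lambda>s. abs_radial_L2 (\<lambda>x :: 'a. s (sphere_index x))) ` {s. \<forall>n. cmod (s n) \<le> ?K}"
  have "I01 f \<in> ?D" if f: "f \<in> cball 0 1" for f :: "'a radial_L2"
  proof (rule image_eqI)
    define u where "u x = cinner f (I01_section x)" for x
    have u: "radial_L2_fun u"
      unfolding u_def by (rule radial_L2_fun_I01_section)
    have "u x = u (sphere_pt (sphere_index x))" if x: "x \<in> O_K" "x \<noteq> 0" for x
    proof -
      obtain m where m: "x \<in> sphere_K m"
        by (rule sphere_K_cases[OF x])
      then have "sphere_index x = m"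
        unfolding sphere_index_def by (rule the_equality) (rule sphere_K_disjoint[OF _ m])
      then show ?thesis
        using radial_eq_sphere_pt[OF _ m, of u] u by (simp add: radial_L2_fun_def)
    qed
    then have "abs_radial_L2 u = abs_radial_L2 (\<lambda>x. u (sphere_pt (sphere_index x)))"
      by (rule abs_radial_L2_cong[OF u])
    then show "I01 f = abs_radial_L2 (\<lambda>x. u (sphere_pt (sphere_index x)))"
      unfolding u_def I01_eq .
    have "cmod (u (sphere_pt n)) \<le> ?K" for n
    proof -
      have "cmod (u (sphere_pt n)) \<le> ?K * norm f"
        unfolding u_def by (intro cmod_I01_section_le subsetD[OF sphere_K_subset sphere_pt])
      also have "\<dots> \<le> ?K"
        using f I01_bound_nonneg[where 'a='a] by (intro mult_left_le) auto
      finally show ?thesis .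
    qed
    then show "(\<lambda>n. u (sphere_pt n)) \<in> {s. \<forall>n. cmod (s n) \<le> ?K}"
      by simp
  qed
  then have sub: "I01 ` cball 0 1 \<subseteq> ?D"
    by blast
  have D: "compact ?D"
    by (rule compact_bounded_radial)
  then have "closure (I01 ` cball 0 1) \<subseteq> ?D"
    by (intro closure_minimal sub compact_imp_closed)
  then have "compact (closure (I01 ` cball 0 1) :: 'a radial_L2 set)"
    using closed_Int_compact[OF closed_closure D] by (metis inf.absorb1)
  then show ?thesis
    by (simp add: compact_operator_def bounded_clinear_I01)
qed


section \<open>The adjoint and the imaginary part\<close>

definition radial_one :: "'a::local_field radial_L2" where
  "radial_one = abs_radial_L2 (\<lambda>x. 1)"

definition radial_ln :: "'a::local_field radial_L2" where
  "radial_ln = abs_radial_L2 (\<lambda>x. complex_of_real (ln (absK x)))"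

lemma radial_L2_fun_ln: "radial_L2_fun (\<lambda>x. complex_of_real (ln (absK x)))"
  using radial_L2_fun_ln_absK[of 1] by simp

lemma ln_absK_sphere_pt:
  "ln (absK (sphere_pt n :: 'a::local_field)) = - real n * ln (real (residue_card TYPE('a)))"
  by (rule ln_absK_sphere[OF sphere_pt])

lemma cinner_radial_one:
  "cinner (radial_one :: 'a::local_field radial_L2) (sphere_vec n) = sphere_mass TYPE('a) n"
  by (simp add: radial_one_def cinner_sphere_vec radial_L2_fun_const)

lemma cinner_radial_ln:
  "cinner (radial_ln :: 'a::local_field radial_L2) (sphere_vec n) =
    complex_of_real (- real n * ln (real (residue_card TYPE('a))) * sphere_mass TYPE('a) n)"
  by (simp add: radial_ln_def cinner_sphere_vec[OF radial_L2_fun_ln] ln_absK_sphere_pt)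

lemma cinner_radial_one_ln:
  "cinner (radial_one :: 'a radial_L2) radial_ln = cinner (radial_ln :: 'a::local_field radial_L2) radial_one"
  by (simp add: radial_one_def radial_ln_def cinner_abs_radial_L2 radial_L2_fun_const radial_L2_fun_ln)

text \<open>Subtraction of natural numbers truncates at zero and thereby absorbs the condition |y| <
  |x|.\<close>

lemma I01_kernel_sphere_pt:
  "I01_kernel (sphere_pt m) (sphere_pt n :: 'a::local_field) =
    complex_of_real (I01_const TYPE('a) * ln (real (residue_card TYPE('a))) * real (n - m))"
  by (simp add: I01_kernel_def sphere_K_less_iff[OF sphere_pt sphere_pt] ln_absK_sphere_pt
      of_nat_diff algebra_simps)

lemma sphere_pt_in_O: "sphere_pt n \<in> O_K"
  by (rule subsetD[OF sphere_K_subset sphere_pt])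

lemma cinner_I01_section_sphere_pt:
  "cinner (I01_section (sphere_pt m)) (sphere_vec n :: 'a::local_field radial_L2) =
    complex_of_real (I01_const TYPE('a) * ln (real (residue_card TYPE('a))) * real (n - m) * sphere_mass TYPE('a) n)"
  unfolding I01_section_def
  by (simp add: cinner_sphere_vec[OF radial_L2_fun_I01_kernel[OF sphere_pt_in_O]] I01_kernel_sphere_pt)

lemma cinner_I01_sphere_vec:
  "cinner (I01 f) (sphere_vec m :: 'a::local_field radial_L2) =
    cinner f (I01_section (sphere_pt m)) * sphere_mass TYPE('a) m"
  by (simp add: I01_eq cinner_sphere_vec[OF radial_L2_fun_I01_section])

text \<open>Written as \<open>I01\<close> minus a finite-rank operator rather than as an integral
  over |y| > |x|: boundedness is then inherited, and the imaginary part can be read off.\<close>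

definition I01_adjoint :: "'a::local_field radial_L2 \<Rightarrow> 'a radial_L2" where
  "I01_adjoint f = I01 f - scaleC (I01_const TYPE('a))
    (scaleC (cinner f radial_one) radial_ln - scaleC (cinner f radial_ln) radial_one)"

lemma cinner_I01_adjoint_sphere_vec:
  "cinner (I01 (sphere_vec n)) (sphere_vec m :: 'a::local_field radial_L2) =
    cinner (sphere_vec n :: 'a radial_L2) (I01_adjoint (sphere_vec m))"
proof -
  let ?l = "ln (real (residue_card TYPE('a)))" and ?w = "sphere_mass TYPE('a)"
  have flip: "cinner (sphere_vec k) g = cnj (cinner g (sphere_vec k))" for k and g :: "'a radial_L2"
    by (rule cinner_commute)
  \<comment> \<open>Positive part minus negative part of n - m. This identity carries the adjoint
    relation; the rest is ring arithmetic.\<close>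
  have nm: "real (n - m) = real (m - n) - (real m - real n)"
    by (cases "m \<le> n") (simp_all add: of_nat_diff)
  have "I01_const TYPE('a) * ?l * real (n - m) * ?w n * ?w m =
      I01_const TYPE('a) * ?l * real (m - n) * ?w m * ?w n -
      I01_const TYPE('a) * (?w m * (- real n * ?l * ?w n) - (- real m * ?l * ?w m) * ?w n)"
    unfolding nm by (simp add: algebra_simps)
  then have "complex_of_real (I01_const TYPE('a) * ?l * real (n - m) * ?w n * ?w m) =
      complex_of_real (I01_const TYPE('a) * ?l * real (m - n) * ?w m * ?w n -
      I01_const TYPE('a) * (?w m * (- real n * ?l * ?w n) - (- real m * ?l * ?w m) * ?w n))"
    by (rule arg_cong)
  then show ?thesis
    unfolding cinner_I01_sphere_vec
    unfolding flip[of n] I01_adjoint_def cinner_diff_left cinner_scaleC_left cinner_I01_sphere_vec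
    unfolding flip[of m] flip[of n] cinner_I01_section_sphere_pt cinner_radial_one cinner_radial_ln
    by simp
qed

lemma bounded_linear_I01: "bounded_linear (I01 :: 'a::local_field radial_L2 \<Rightarrow> 'a radial_L2)"
  using bounded_clinear_I01[where 'a='a] by (simp add: bounded_clinear_def)

lemma I01_scaleC: "I01 (scaleC c f) = scaleC c (I01 (f :: 'a::local_field radial_L2))"
  using bounded_clinear_I01[where 'a='a] by (simp add: bounded_clinear_def)

lemma bounded_linear_I01_adjoint: "bounded_linear I01_adjoint"
  unfolding I01_adjoint_def[abs_def]
  by (intro bounded_linear_sub bounded_linear_I01 bounded_linear_compose[OF bounded_linear_scaleC]
      bounded_linear_compose[OF bounded_linear_scaleC_left bounded_linear_cinner_left])

lemma I01_adjoint_scaleC: "I01_adjoint (scaleC c f) = scaleC c (I01_adjoint f)"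
  by (simp add: I01_adjoint_def I01_scaleC cinner_scaleC_left scaleC_diff_right scaleC_scaleC mult_ac)

text \<open>Density extends the relation from sphere vectors one argument at a time, first in the
  linear, then in the antilinear one.\<close>

lemma cinner_I01_adjoint: "cinner (I01 f) g = cinner f (I01_adjoint g)"
proof -
  have *: "cinner (I01 f) (sphere_vec m) - cinner f (I01_adjoint (sphere_vec m)) = 0" for f :: "'a radial_L2" and m
    by (rule bounded_linear_eq_0_on_sphere_vec[of
          "\<lambda>f. cinner (I01 f) (sphere_vec m) - cinner f (I01_adjoint (sphere_vec m))"])
      (auto intro!: bounded_linear_sub bounded_linear_cinner_left
        bounded_linear_compose[OF bounded_linear_cinner_left bounded_linear_I01]
        simp: I01_scaleC cinner_scaleC_left cinner_I01_adjoint_sphere_vec)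
  have "cinner (I01 f) g - cinner f (I01_adjoint g) = 0"
  proof (rule bounded_linear_eq_0_on_sphere_vec[of "\<lambda>g. cinner (I01 f) g - cinner f (I01_adjoint g)"])
    show "bounded_linear (\<lambda>g. cinner (I01 f) g - cinner f (I01_adjoint g))"
      by (intro bounded_linear_sub bounded_linear_cinner_right
          bounded_linear_compose[OF bounded_linear_cinner_right bounded_linear_I01_adjoint])
    show "cinner (I01 f) (scaleC c (sphere_vec n)) - cinner f (I01_adjoint (scaleC c (sphere_vec n))) = 0" for c n
      using *[of f n] by (simp add: I01_adjoint_scaleC cinner_scaleC_right)
  qed
  then show ?thesis
    by simp
qed

lemma cadjoint_I01: "cadjoint I01 = I01_adjoint"
  by (rule cadjoint_eqI) (rule cinner_I01_adjoint)

section \<open>The imaginary part in closed form\<close>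

definition I01_imag_const :: "'a::local_field itself \<Rightarrow> complex" where
  "I01_imag_const T = complex_of_real (I01_const T) / (2 * \<i>)"

lemma imaginary_part_I01:
  "imaginary_part I01 (f :: 'a::local_field radial_L2) = scaleC (I01_imag_const TYPE('a))
    (scaleC (cinner f radial_one) radial_ln - scaleC (cinner f radial_ln) radial_one)"
  by (simp add: imaginary_part_def cadjoint_I01 I01_adjoint_def I01_imag_const_def scaleC_scaleC)

lemma ln_residue_card_pos: "ln (real (residue_card TYPE('a::local_field))) > 0"
  using residue_card_gt_1[where 'a='a] by simp

lemma I01_const_nonzero: "I01_const TYPE('a::local_field) \<noteq> 0"
  using residue_card_gt_1[where 'a='a] ln_residue_card_pos[where 'a='a] by (simp add: I01_const_def)

lemma I01_imag_const_nonzero: "I01_imag_const TYPE('a::local_field) \<noteq> 0"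
  using I01_const_nonzero[where 'a='a] by (simp add: I01_imag_const_def)

lemma sphere_mass_nonzero: "complex_of_real (sphere_mass TYPE('a::local_field) n) \<noteq> 0"
  using measure_sphere_K_pos[where 'a='a and n = n] by simp

lemma cinner_sphere_vec_radial_one:
  "cinner (sphere_vec n) (radial_one :: 'a::local_field radial_L2) = sphere_mass TYPE('a) n"
  by (subst cinner_commute) (simp add: cinner_radial_one)

lemma cinner_sphere_vec_radial_ln:
  "cinner (sphere_vec n) (radial_ln :: 'a::local_field radial_L2) =
    complex_of_real (- real n * ln (real (residue_card TYPE('a))) * sphere_mass TYPE('a) n)"
  by (subst cinner_commute) (simp add: cinner_radial_ln)

text \<open>Linear independence of 1 and ln |x|: the logarithm vanishes on the unit sphere, which
  isolates \<open>b\<close>, and the next sphere then gives \<open>a\<close>.\<close>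

lemma scaleC_radial_ln_eq_one_imp:
  assumes eq: "scaleC a radial_ln = scaleC b (radial_one :: 'a::local_field radial_L2)"
  shows "a = 0 \<and> b = 0"
proof
  have *: "a * cinner (radial_ln :: 'a radial_L2) (sphere_vec n) = b * cinner (radial_one :: 'a radial_L2) (sphere_vec n)" for n
    using arg_cong[OF eq, of "\<lambda>f. cinner f (sphere_vec n)"] by (simp add: cinner_scaleC_left)
  show b: "b = 0"
    using *[of 0] sphere_mass_nonzero[where 'a='a] by (simp add: cinner_radial_one cinner_radial_ln)
  show "a = 0"
    using *[of 1] sphere_mass_nonzero[where 'a='a and n = 1] b ln_residue_card_pos[where 'a='a]
    by (simp add: cinner_radial_one cinner_radial_ln)
qed


section \<open>The Volterra property\<close>

lemma volterra_operator_I01: "volterra_operator (I01 :: 'a::local_field radial_L2 \<Rightarrow> 'a radial_L2)"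
proof -
  have sub: "op_spectrum (I01 :: 'a radial_L2 \<Rightarrow> _) \<subseteq> {0}"
    by (rule op_spectrum_quasinilpotent[OF compact_operator_I01 norm_I01_power summable_I01_power_bound])
  \<comment> \<open>Integration over |y| < |x| \<le> 1 never reaches |y| = 1, so the unit sphere
    indicator is an eigenvector for 0.\<close>
  have ker: "I01 (sphere_vec 0 :: 'a radial_L2) = 0"
  proof (rule sphere_vec_eqI)
    fix m
    have "cinner (sphere_vec 0 :: 'a radial_L2) (I01_section (sphere_pt m)) = 0"
      by (subst cinner_commute) (simp add: cinner_I01_section_sphere_pt)
    then show "cinner (I01 (sphere_vec 0 :: 'a radial_L2)) (sphere_vec m) = cinner 0 (sphere_vec m :: 'a radial_L2)"
      by (simp add: cinner_I01_sphere_vec cinner_zero_left)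
  qed
  have "0 \<in> op_spectrum (I01 :: 'a radial_L2 \<Rightarrow> _)"
  proof (rule ccontr)
    assume "0 \<notin> op_spectrum (I01 :: 'a radial_L2 \<Rightarrow> _)"
    then obtain B where B: "\<And>x :: 'a radial_L2. B (I01 x - scaleC 0 x) = x"
      unfolding op_spectrum_def by blast
    have "B 0 = sphere_vec 0" "B 0 = 0"
      using B[of "sphere_vec 0"] B[of 0] ker linear_0[OF bounded_linear.linear[OF bounded_linear_I01[where 'a='a]]]
      by simp_all
    then have "cinner (sphere_vec 0) (sphere_vec 0 :: 'a radial_L2) = 0"
      by (simp add: cinner_zero_left)
    then show False
      using sphere_mass_nonzero[where 'a='a and n=0] by (simp add: cinner_sphere_vec_sphere_vec)
  qed
  with sub show ?thesis
    by (auto simp: volterra_operator_def compact_operator_I01)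
qed


section \<open>Simplicity\<close>

lemma I01_kernel_trivial:
  fixes f :: "'a::local_field radial_L2"
  assumes "I01 f = 0" and one: "cinner f radial_one = 0" and ln: "cinner f radial_ln = 0"
  shows "f = 0"
proof (rule sphere_vec_eqI)
  let ?c = "complex_of_real (I01_const TYPE('a) * ln (real (residue_card TYPE('a))))"
  have c: "?c \<noteq> 0"
    using I01_const_nonzero[where 'a='a] ln_residue_card_pos[where 'a='a] by simp
  have sec: "cinner f (I01_section (sphere_pt m)) = 0" for m
    using cinner_I01_sphere_vec[of f m] assms(1) sphere_mass_nonzero[where 'a='a and n = m]
    by (simp add: cinner_zero_left)
  \<comment> \<open>As functions of the radius, the sections are ramps, and the second difference of a ramp is a
    delta function.\<close>
  have "cinner f (scaleC ?c (sphere_vec n)) = 0" for n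
  proof (cases n)
    case 0
    \<comment> \<open>The second difference at 0 calls for a ramp starting at index -1, which no
      section provides. On k >= 0 that ramp is affine, proportional to k + 1, hence a combination of
      1 and ln |x|; here the two orthogonality assumptions enter.\<close>
    have eq0: "scaleC ?c (sphere_vec 0) = scaleC ?c radial_one
        - scaleC (complex_of_real (I01_const TYPE('a))) radial_ln
        - scaleC 2 (I01_section (sphere_pt 0)) + I01_section (sphere_pt 1 :: 'a)"
    proof (rule sphere_vec_eqI)
      fix k
      have eq: "1 + real k - 2 * real k + real (k - 1) = (if 0 = k then 1 else 0)"
        by (cases k) auto
      have "cinner (scaleC ?c radial_one
        - scaleC (complex_of_real (I01_const TYPE('a))) radial_ln
        - scaleC 2 (I01_section (sphere_pt 0)) + I01_section (sphere_pt 1 :: 'a)) (sphere_vec k) =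
          ?c * complex_of_real (1 + real k - 2 * real k + real (k - 1)) * sphere_mass TYPE('a) k"
        by (simp add: cinner_add_left cinner_diff_left cinner_scaleC_left
            cinner_I01_section_sphere_pt cinner_radial_one cinner_radial_ln algebra_simps)
      also have "\<dots> = cinner (scaleC ?c (sphere_vec 0)) (sphere_vec k :: 'a radial_L2)"
        unfolding eq by (simp add: cinner_scaleC_left cinner_sphere_vec_sphere_vec)
      finally show "cinner (scaleC ?c (sphere_vec 0)) (sphere_vec k :: 'a radial_L2) = cinner (scaleC ?c radial_one
        - scaleC (complex_of_real (I01_const TYPE('a))) radial_ln
        - scaleC 2 (I01_section (sphere_pt 0)) + I01_section (sphere_pt 1 :: 'a)) (sphere_vec k)"
        by (rule sym)
    qed
    show ?thesis
      unfolding 0 eq0 by (simp add: cinner_add_right cinner_diff_right cinner_scaleC_right sec one ln)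
  next
    case (Suc m)
    have eqS: "scaleC ?c (sphere_vec (Suc m)) = I01_section (sphere_pt m)
        - scaleC 2 (I01_section (sphere_pt (Suc m))) + I01_section (sphere_pt (Suc (Suc m)) :: 'a)"
    proof (rule sphere_vec_eqI)
      fix k
      have eq: "real (k - m) - 2 * real (k - Suc m) + real (k - Suc (Suc m)) = (if Suc m = k then 1 else 0)"
        by (cases "k \<le> Suc m") (auto simp: of_nat_diff le_Suc_eq)
      have "cinner (I01_section (sphere_pt m)
        - scaleC 2 (I01_section (sphere_pt (Suc m))) + I01_section (sphere_pt (Suc (Suc m)) :: 'a)) (sphere_vec k) =
          ?c * complex_of_real (real (k - m) - 2 * real (k - Suc m) + real (k - Suc (Suc m)))
            * sphere_mass TYPE('a) k"
        by (simp add: cinner_add_left cinner_diff_left cinner_scaleC_left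
            cinner_I01_section_sphere_pt algebra_simps)
      also have "\<dots> = cinner (scaleC ?c (sphere_vec (Suc m))) (sphere_vec k :: 'a radial_L2)"
        unfolding eq by (simp add: cinner_scaleC_left cinner_sphere_vec_sphere_vec)
      finally show "cinner (scaleC ?c (sphere_vec (Suc m))) (sphere_vec k :: 'a radial_L2) = cinner (I01_section (sphere_pt m)
        - scaleC 2 (I01_section (sphere_pt (Suc m))) + I01_section (sphere_pt (Suc (Suc m)) :: 'a)) (sphere_vec k)"
        by (rule sym)
    qed
    show ?thesis
      unfolding Suc eqS by (simp add: cinner_add_right cinner_diff_right cinner_scaleC_right sec)
  qed
  then show "cinner f (sphere_vec n) = cinner 0 (sphere_vec n)" for n
    using c by (simp add: cinner_scaleC_right cinner_zero_left)
qed

lemma simple_operator_I01: "simple_operator (I01 :: 'a::local_field radial_L2 \<Rightarrow> 'a radial_L2)"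
  unfolding simple_operator_def cadjoint_I01
proof clarify
  fix M :: "'a radial_L2 set"
  assume sub: "csubspace M" and ne: "M \<noteq> {0}" and inv: "I01 ` M \<subseteq> M"
    and eq: "\<forall>x\<in>M. I01 x = I01_adjoint x"
  have "f = 0" if f: "f \<in> M" for f
  proof (rule I01_kernel_trivial)
    show "I01 f = 0"
    proof (rule symmetric_quasinilpotent_eq_0[OF norm_I01_power summable_I01_power_bound inv _ f])
      show "cinner (I01 x) y = cinner x (I01 y)" if "x \<in> M" "y \<in> M" for x y
        using cinner_I01_adjoint[of x y] eq that by simp
    qed
    \<comment> \<open>Agreement with the adjoint says that the finite-rank difference kills
      \<open>f\<close>; independence of 1 and ln |x| forces both coefficients to vanish.\<close>
    have "scaleC (I01_const TYPE('a))
        (scaleC (cinner f radial_one) radial_ln - scaleC (cinner f radial_ln) (radial_one :: 'a radial_L2)) = 0"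
      using bspec[OF eq f] by (simp add: I01_adjoint_def)
    then have "scaleC (cinner f radial_one) radial_ln = scaleC (cinner f radial_ln) (radial_one :: 'a radial_L2)"
      using I01_const_nonzero[where 'a='a] by (simp add: complex_vector.scale_eq_0_iff)
    then show "cinner f radial_one = 0" "cinner f radial_ln = 0"
      using scaleC_radial_ln_eq_one_imp by blast+
  qed
  moreover have "0 \<in> M"
    using sub by (rule complex_vector.subspace_0)
  ultimately show False
    using ne by blast
qed


section \<open>Rank and trace of the imaginary part\<close>

lemma range_imaginary_part_I01:
  "range (imaginary_part (I01 :: 'a::local_field radial_L2 \<Rightarrow> 'a radial_L2)) = cspan {radial_ln, radial_one}"
proof
  let ?J = "imaginary_part (I01 :: 'a radial_L2 \<Rightarrow> 'a radial_L2)"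
  let ?c = "I01_imag_const TYPE('a)" and ?l = "ln (real (residue_card TYPE('a)))"
  have J_add: "?J (f + g) = ?J f + ?J g" for f g
    by (simp add: imaginary_part_I01 cinner_add_left scaleC_add_left scaleC_add_right scaleC_diff_right)
  have J_scale: "?J (scaleC a f) = scaleC a (?J f)" for a f
    by (simp add: imaginary_part_I01 cinner_scaleC_left scaleC_diff_right scaleC_scaleC mult_ac)
  show "range ?J \<subseteq> cspan {radial_ln, radial_one}"
    unfolding imaginary_part_I01
    by (intro image_subsetI complex_vector.span_scale complex_vector.span_diff complex_vector.span_base) auto
  have "csubspace (range ?J)"
    unfolding complex_vector.subspace_def
  proof (intro conjI ballI allI)
    show "0 \<in> range ?J"
      using J_scale[of 0 0] by (metis complex_vector.scale_zero_left rangeI)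
  qed (auto simp flip: J_add J_scale)
  moreover have "radial_ln \<in> range ?J"
  proof (rule range_eqI)
    \<comment> \<open>The unit sphere indicator is orthogonal to ln |x|, so only the other term
      survives.\<close>
    have "?J (sphere_vec 0) = scaleC (?c * sphere_mass TYPE('a) 0) radial_ln"
      by (simp add: imaginary_part_I01 cinner_sphere_vec_radial_one cinner_sphere_vec_radial_ln scaleC_scaleC)
    then show "radial_ln = ?J (scaleC (1 / (?c * sphere_mass TYPE('a) 0)) (sphere_vec 0))"
      using I01_imag_const_nonzero[where 'a='a] sphere_mass_nonzero[where 'a='a and n = 0]
      by (simp add: J_scale scaleC_scaleC)
  qed
  moreover have "radial_one \<in> range ?J"
  proof -
    let ?w = "\<lambda>n. complex_of_real (sphere_mass TYPE('a) n)"
    \<comment> \<open>The weights make the vector orthogonal to 1 and give it inner product -ln q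
      with ln |x|.\<close>
    have "?J (scaleC (1 / ?w 1) (sphere_vec 1) + scaleC (- 1 / ?w 0) (sphere_vec 0)) = scaleC (?c * ?l) radial_one"
      using sphere_mass_nonzero[where 'a='a and n = 0] sphere_mass_nonzero[where 'a='a and n = 1]
      by (simp add: imaginary_part_I01 cinner_diff_left cinner_scaleC_left cinner_sphere_vec_radial_one
          cinner_sphere_vec_radial_ln scaleC_scaleC)
    then have "radial_one = ?J (scaleC (1 / (?c * ?l))
        (scaleC (1 / ?w 1) (sphere_vec 1) + scaleC (- 1 / ?w 0) (sphere_vec 0)))"
      using I01_imag_const_nonzero[where 'a='a] ln_residue_card_pos[where 'a='a]
      by (simp add: J_scale scaleC_scaleC)
    then show ?thesis
      by (rule range_eqI)
  qed
  ultimately show "cspan {radial_ln, radial_one} \<subseteq> range ?J"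
    by (intro complex_vector.span_minimal) auto
qed

lemma op_rank_imaginary_part_I01:
  "op_rank (imaginary_part (I01 :: 'a::local_field radial_L2 \<Rightarrow> 'a radial_L2)) = 2"
proof -
  have one: "radial_one \<noteq> (0 :: 'a radial_L2)"
    using scaleC_radial_ln_eq_one_imp[of 0 1] by auto
  have "radial_ln \<noteq> scaleC k (radial_one :: 'a radial_L2)" for k
    using scaleC_radial_ln_eq_one_imp[of 1 k] by auto
  then have ln: "radial_ln \<notin> cspan {radial_one :: 'a radial_L2}"
    by (auto simp: complex_vector.span_singleton)
  then have ne: "radial_ln \<noteq> (radial_one :: 'a radial_L2)"
    using complex_vector.span_base[of radial_one "{radial_one}"] by auto
  have "complex_vector.independent {radial_ln, radial_one :: 'a radial_L2}"
    using one ln ne by (simp add: complex_vector.independent_insert)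
  then have "cdim {radial_ln, radial_one :: 'a radial_L2} = card {radial_ln, radial_one :: 'a radial_L2}"
    by (rule complex_vector.dim_eq_card_independent)
  then show ?thesis
    using ne by (simp add: op_rank_def range_imaginary_part_I01 complex_vector.dim_span)
qed

text \<open>Parseval evaluates the diagonal sum in any basis to a multiple of the inner product of
  ln |x| with 1 minus the same product in reverse order; the two agree because both functions are
  real.\<close>

lemma has_trace_imaginary_part_I01:
  "has_trace (imaginary_part (I01 :: 'a::local_field radial_L2 \<Rightarrow> 'a radial_L2)) 0"
  unfolding has_trace_def
proof (intro conjI ex_orthonormal_basis allI impI)
  fix E :: "'a radial_L2 set" assume E: "orthonormal_basis E"
  have "((\<lambda>e. cinner radial_ln e * cinner e radial_one + - (cinner radial_one e * cinner e radial_ln)) has_sum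
      (cinner (radial_ln :: 'a radial_L2) radial_one + - cinner radial_one (radial_ln :: 'a radial_L2))) E"
    by (intro has_sum_add has_sum_uminusI orthonormal_basis_has_sum E)
  then have "((\<lambda>e. I01_imag_const TYPE('a) *
      (cinner radial_ln e * cinner e radial_one + - (cinner radial_one e * cinner e radial_ln))) has_sum
      I01_imag_const TYPE('a) * (cinner (radial_ln :: 'a radial_L2) radial_one + - cinner radial_one (radial_ln :: 'a radial_L2))) E"
    by (rule has_sum_cmult_right)
  then show "((\<lambda>e. cinner (imaginary_part I01 e) e) has_sum 0) E"
    by (simp add: imaginary_part_I01 cinner_scaleC_left cinner_diff_left cinner_radial_one_ln mult_ac)
qed

theorem theorem2:
  shows "volterra_operator (I01 :: 'a::local_field radial_L2 \<Rightarrow> 'a radial_L2) \<and>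
    simple_operator (I01 :: 'a radial_L2 \<Rightarrow> 'a radial_L2) \<and>
    op_rank (imaginary_part (I01 :: 'a radial_L2 \<Rightarrow> 'a radial_L2)) = 2 \<and>
    has_trace (imaginary_part (I01 :: 'a radial_L2 \<Rightarrow> 'a radial_L2)) 0"
  by (intro conjI volterra_operator_I01 simple_operator_I01 op_rank_imaginary_part_I01
      has_trace_imaginary_part_I01)

end
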